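(* Let $K$ be a number field, $\overline{K}$ an algebraic closure of $K$, $K_{ab}\subseteq\overline{K}$ the maximal abelian extension of $K$, and $E/K$ an elliptic curve over $K$. Then for any complex conjugation automorphism $\sigma\in Gal(\overline{K}/K)$, the group $E((K_{ab})^{\sigma})$ has infinite rank. Hence $E(\overline{K}^{\sigma})$ has infinite rank.
   Context: A complex conjugation automorphism is an element $\sigma\in Gal(\overline{K}/K)$ of order $2$. For a subfield $M\subseteq\overline{K}$ with $\sigma(M)=M$, $M^{\sigma}$ denotes the subfield of $M$ fixed by $\sigma$. *)

theory Defs
  imports
    "HOL-Algebra.Algebra"
    "HOL-Algebra.Algebraic_Closure_Type"
    "HOL-Computational_Algebra.Computational_Algebra"
    "HOL-Library.Extended_Nat"
begin

text \<open>
  The ambient algebraic closure is a type \<open>'a\<close> of an algebraically closed field, regarded as a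
  record structure where notions from the algebra library are needed.  All other fields are
  subsets of it.
\<close>

abbreviation is_subfield :: "'a::field set \<Rightarrow> bool" where
  "is_subfield K \<equiv> subfield K ring_of_type_algebra"

lemma is_subfield_iff:
  fixes K :: "'a::field set"
  shows "is_subfield K \<longleftrightarrow>
    0 \<in> K \<and> 1 \<in> K \<and> (\<forall>x\<in>K. \<forall>y\<in>K. x + y \<in> K \<and> x * y \<in> K) \<and>
    (\<forall>x\<in>K. - x \<in> K \<and> inverse x \<in> K)"
proof -
  define R where "R = (ring_of_type_algebra :: 'a ring)"
  interpret R: field R
    unfolding R_def by (rule field_from_type_algebra)
  have ops: "carrier R = UNIV" "monoid.mult R = (*)" "monoid.one R = 1"
      "ring.zero R = 0" "ring.add R = (+)"
    by (simp_all add: R_def ring_of_type_algebra_def)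
  have neg: "a_inv R x = - x" for x
    using R.add.inv_equality[of "- x" x] by (simp add: ops)
  have recip: "m_inv R x = inverse x" if "x \<noteq> 0" for x
    using that R.inv_unique'[of x "inverse x"] by (simp add: ops)
  show ?thesis
    unfolding R_def[symmetric]
  proof
    assume "subfield K R"
    then interpret S: subfield K R .
    have "inverse x \<in> K" if "x \<in> K" for x
    proof (cases "x = 0")
      case True
      then show ?thesis using that by simp
    next
      case False
      then show ?thesis
        using R.subfield_m_inv(1)[OF \<open>subfield K R\<close>, of x] that
        by (simp add: recip ops)
    qed
    then show "0 \<in> K \<and> 1 \<in> K \<and> (\<forall>x\<in>K. \<forall>y\<in>K. x + y \<in> K \<and> x * y \<in> K) \<and>
        (\<forall>x\<in>K. - x \<in> K \<and> inverse x \<in> K)"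
      using S.subring_axioms R.subring_props[OF \<open>subfield K R\<close>]
      by (auto simp: ops neg)
  next
    assume K: "0 \<in> K \<and> 1 \<in> K \<and> (\<forall>x\<in>K. \<forall>y\<in>K. x + y \<in> K \<and> x * y \<in> K) \<and>
        (\<forall>x\<in>K. - x \<in> K \<and> inverse x \<in> K)"
    have "subring K R"
      by (rule R.subringI) (use K in \<open>auto simp: ops neg\<close>)
    then show "subfield K R"
      by (rule R.subfieldI') (use K in \<open>auto simp: ops recip\<close>)
  qed
qed

lemma vector_space_of_rat: "vector_space (\<lambda>(q::rat) (x::'a::field_char_0). of_rat q * x)"
  by unfold_locales (simp_all add: algebra_simps of_rat_add of_rat_mult)

definition number_field :: "'a::field_char_0 set \<Rightarrow> bool" where
  "number_field K \<longleftrightarrow> is_subfield K \<and>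
     (\<exists>B. finite B \<and> K = module.span (\<lambda>(q::rat) x. of_rat q * x) B)"

definition algebraic_over :: "'a::field set \<Rightarrow> 'a \<Rightarrow> bool" where
  "algebraic_over K x \<longleftrightarrow> (\<exists>p. p \<noteq> 0 \<and> (\<forall>i. coeff p i \<in> K) \<and> poly p x = 0)"

text \<open>
  Automorphisms of \<open>M\<close> are functions on the whole ambient type; as in \<^const>\<open>Bij\<close> they are made
  unique by being \<^const>\<open>undefined\<close> outside \<open>M\<close>.
\<close>

definition Gal :: "'a::field set \<Rightarrow> 'a set \<Rightarrow> ('a \<Rightarrow> 'a) monoid" where
  "Gal M K = (BijGroup M)\<lparr>carrier :=
     {f \<in> Bij M. (\<forall>x\<in>M. \<forall>y\<in>M. f (x + y) = f x + f y \<and> f (x * y) = f x * f y) \<and>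
                 (\<forall>x\<in>K. f x = x)}\<rparr>"

lemma group_Gal:
  fixes M K :: "'a::field set"
  assumes M: "is_subfield M" and KM: "K \<subseteq> M"
  shows "group (Gal M K)"
proof -
  let ?G = "BijGroup M"
  let ?H = "{f \<in> Bij M. (\<forall>x\<in>M. \<forall>y\<in>M. f (x + y) = f x + f y \<and> f (x * y) = f x * f y) \<and>
                 (\<forall>x\<in>K. f x = x)}"
  interpret G: group ?G by (rule group_BijGroup)
  have cl: "x + y \<in> M" "x * y \<in> M" if "x \<in> M" "y \<in> M" for x y
    using M that by (auto simp: is_subfield_iff)
  have "subgroup ?H ?G"
  proof (rule G.subgroupI)
    show "?H \<subseteq> carrier ?G" by (auto simp: BijGroup_def)
    have "(\<lambda>x\<in>M. x) \<in> ?H" using cl KM by (auto simp: id_Bij)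
    then show "?H \<noteq> {}" by blast
  next
    fix f assume f: "f \<in> ?H"
    then have fB: "f \<in> Bij M" by simp
    have fs: "(+) \<in> M \<rightarrow> M \<rightarrow> M" "(*) \<in> M \<rightarrow> M \<rightarrow> M" using cl by auto
    have "inv_into M f (x + y) = inv_into M f x + inv_into M f y"
      if "x \<in> M" "y \<in> M" for x y
      by (rule Bij_inv_into_lemma[OF _ fB fs(1) that]) (use f in auto)
    moreover have "inv_into M f (x * y) = inv_into M f x * inv_into M f y"
      if "x \<in> M" "y \<in> M" for x y
      by (rule Bij_inv_into_lemma[OF _ fB fs(2) that]) (use f in auto)
    moreover have "inv_into M f x = x" if "x \<in> K" for x
    proof -
      have "inj_on f M" "f x = x" "x \<in> M"
        using f that KM by (auto simp: Bij_def bij_betw_def)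
      then show ?thesis using inv_into_f_f[of f M x] by simp
    qed
    ultimately show "inv\<^bsub>?G\<^esub> f \<in> ?H"
      using cl KM restrict_inv_into_Bij[OF fB] by (auto simp: inv_BijGroup[OF fB])
  next
    fix f g assume "f \<in> ?H" "g \<in> ?H"
    then show "f \<otimes>\<^bsub>?G\<^esub> g \<in> ?H"
      using cl KM Bij_imp_funcset[of g M]
      by (auto simp: BijGroup_def compose_Bij compose_eq Pi_iff subset_iff)
  qed
  then show ?thesis
    unfolding Gal_def by (rule G.subgroup_imp_group)
qed

definition fixed_field :: "'a set \<Rightarrow> ('a \<Rightarrow> 'a) \<Rightarrow> 'a set" where
  "fixed_field M \<sigma> = {x \<in> M. \<sigma> x = x}"

definition galois_extension :: "'a::field set \<Rightarrow> 'a set \<Rightarrow> bool" where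
  "galois_extension K M \<longleftrightarrow>
     is_subfield K \<and> is_subfield M \<and> K \<subseteq> M \<and> (\<forall>x\<in>M. algebraic_over K x) \<and>
     {x \<in> M. \<forall>f \<in> carrier (Gal M K). f x = x} = K"

definition abelian_extension :: "'a::field set \<Rightarrow> 'a set \<Rightarrow> bool" where
  "abelian_extension K M \<longleftrightarrow> galois_extension K M \<and> comm_group (Gal M K)"

text \<open>The compositum of all abelian extensions of \<open>K\<close> inside the ambient field.\<close>

definition max_abelian_extension :: "'a::field set \<Rightarrow> 'a set" where
  "max_abelian_extension K =
     \<Inter> {L. is_subfield L \<and> (\<forall>M. abelian_extension K M \<longrightarrow> M \<subseteq> L)}"

definition complex_conjugation :: "'a::field set \<Rightarrow> ('a \<Rightarrow> 'a) \<Rightarrow> bool" where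
  "complex_conjugation K \<sigma> \<longleftrightarrow>
     \<sigma> \<in> carrier (Gal UNIV K) \<and> group.ord (Gal UNIV K) \<sigma> = 2"

text \<open>
  Elliptic curves are given by general Weierstrass equations
  $y^2 + a_1 x y + a_3 y = x^3 + a_2 x^2 + a_4 x + a_6$ of nonzero discriminant.
\<close>

record 'a weierstrass =
  wa1 :: 'a
  wa2 :: 'a
  wa3 :: 'a
  wa4 :: 'a
  wa6 :: 'a

definition discriminant :: "'a::field weierstrass \<Rightarrow> 'a" where
  "discriminant E =
    (let b2 = (wa1 E)\<^sup>2 + 4 * wa2 E;
         b4 = 2 * wa4 E + wa1 E * wa3 E;
         b6 = (wa3 E)\<^sup>2 + 4 * wa6 E;
         b8 = (wa1 E)\<^sup>2 * wa6 E + 4 * wa2 E * wa6 E - wa1 E * wa3 E * wa4 E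
              + wa2 E * (wa3 E)\<^sup>2 - (wa4 E)\<^sup>2
     in - b2\<^sup>2 * b8 - 8 * b4 ^ 3 - 27 * b6\<^sup>2 + 9 * b2 * b4 * b6)"

definition elliptic_curve_over :: "'a::field set \<Rightarrow> 'a weierstrass \<Rightarrow> bool" where
  "elliptic_curve_over K E \<longleftrightarrow>
     {wa1 E, wa2 E, wa3 E, wa4 E, wa6 E} \<subseteq> K \<and> discriminant E \<noteq> 0"

datatype 'a ec_point = Infinity | Affine 'a 'a

definition ec_points :: "'a::field weierstrass \<Rightarrow> 'a set \<Rightarrow> 'a ec_point set" where
  "ec_points E L = insert Infinity
     {Affine x y | x y. x \<in> L \<and> y \<in> L \<and>
        y\<^sup>2 + wa1 E * x * y + wa3 E * y = x ^ 3 + wa2 E * x\<^sup>2 + wa4 E * x + wa6 E}"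

text \<open>
  Chord-tangent addition: \<open>y = l * x + v\<close> is the line through the two points (the tangent line
  if they coincide), and the sum is the negative of the third intersection point, where
  \<open>- (x, y) = (x, - y - a\<^sub>1 x - a\<^sub>3)\<close>.
\<close>

fun ec_add :: "'a::field weierstrass \<Rightarrow> 'a ec_point \<Rightarrow> 'a ec_point \<Rightarrow> 'a ec_point" where
  "ec_add E Infinity Q = Q"
| "ec_add E P Infinity = P"
| "ec_add E (Affine x1 y1) (Affine x2 y2) =
    (if x1 = x2 \<and> y1 + y2 + wa1 E * x2 + wa3 E = 0 then Infinity
     else let l = (if x1 = x2
                   then (3 * x1\<^sup>2 + 2 * wa2 E * x1 + wa4 E - wa1 E * y1)
                          / (2 * y1 + wa1 E * x1 + wa3 E)
                   else (y2 - y1) / (x2 - x1));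
              v = y1 - l * x1;
              x3 = l\<^sup>2 + wa1 E * l - wa2 E - x1 - x2
          in Affine x3 (- (l + wa1 E) * x3 - v - wa3 E))"

definition mordell_weil_group :: "'a::field weierstrass \<Rightarrow> 'a set \<Rightarrow> 'a ec_point monoid" where
  "mordell_weil_group E L =
     \<lparr>carrier = ec_points E L, monoid.mult = ec_add E, one = Infinity\<rparr>"

text \<open>
  The rank of a (multiplicatively written) abelian group is the supremum of the sizes of its
  finite subsets that are linearly independent over the integers.
\<close>

definition int_independent :: "('a, 'b) monoid_scheme \<Rightarrow> 'a set \<Rightarrow> bool" where
  "int_independent G S \<longleftrightarrow> finite S \<and> S \<subseteq> carrier G \<and>
     (\<forall>n :: 'a \<Rightarrow> int. finprod G (\<lambda>x. x [^]\<^bsub>G\<^esub> n x) S = \<one>\<^bsub>G\<^esub> \<longrightarrow> (\<forall>x\<in>S. n x = 0))"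

definition abelian_group_rank :: "('a, 'b) monoid_scheme \<Rightarrow> enat" where
  "abelian_group_rank G = (SUP S \<in> {S. int_independent G S}. enat (card S))"

end

theory Submission
  imports Defs
begin

hide_const (open) Divisibility.prime

text \<open>
  After completing the square the curve is \<open>y\<^sup>2 = f x\<close> with \<open>f\<close> a monic cubic over \<open>K\<close>.  The automorphism
  \<open>\<sigma>\<close> makes its fixed field real closed, so for suitable large \<open>x = D + 1 / (t q)\<close> the value \<open>f x\<close> is
  a square of some \<open>y\<close> fixed by \<open>\<sigma>\<close>, and \<open>K(y)\<close> is an abelian extension of \<open>K\<close>.

  Let \<open>q\<close> run through a sparse sequence of primes.  At an unramified prime \<open>q\<close> the value \<open>f x\<close> has odd
  valuation \<open>-3\<close>, whence the square classes of these values are independent in \<open>K\<close> and each new \<open>y\<close> lies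
  outside the field \<open>F\<close> generated by the previous ones.  A multiple \<open>k P\<close> of the new point that is
  defined over \<open>F\<close> has a \<open>y\<close>-coordinate in both \<open>F\<close> and \<open>F y\<close>, so it is \<open>2\<close>-torsion.  But \<open>P\<close> has infinite
  order: \<open>x\<close> is \<open>2\<close>-adically large by the choice of \<open>t\<close>, and then each doubling multiplies it by \<open>1/4\<close>
  times a \<open>2\<close>-adic unit.  Hence the points are linearly independent.
\<close>

section \<open>The group law\<close>

text \<open>The denominator \<open>t q\<close> serves two places. At 2 it makes \<open>x\<close> odd
  over even; at \<open>q\<close> it makes \<open>(t q)^4 * f x\<close> equal to \<open>q\<close>
  times an element not divisible by \<open>q\<close>, and the factor \<open>(t q)^4\<close> is a
  square. The points live over ever larger fields, but their doublings have
  \<open>x\<close>-coordinates in \<open>K\<close>, so a subring of \<open>K\<close> without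
  \<open>1/2\<close> suffices to show infinite order.

  The term \<open>D = 1 + a^2 + b^2 + c^2\<close> is chosen so that \<open>f x\<close> is visibly
  built from squares of fixed elements; positivity thus reduces to the closure of these squares
  under addition and multiplication.

  The obstacle is to speak of odd valuation without prime ideals, as \<open>q\<close> may split in
  \<open>K\<close>. The substitute is a subring \<open>A\<close> of \<open>K\<close> attached to
  \<open>q\<close> such that \<open>q\<close> divides \<open>u\<close> in \<open>A\<close> as soon
  as \<open>q u\<close> is a square in \<open>K\<close> with \<open>u\<close> in \<open>A\<close>.
  This holds once \<open>A / q A\<close> has no nilpotents, and for almost all \<open>q\<close> that
  comes from separability: the Casimir element of a nondegenerate form on \<open>K\<close>
  multiplies out to a nonzero number, invertible in \<open>A\<close> for almost all
  \<open>q\<close>.\<close>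

lemmas ring_normal = algebra_simps power2_eq_square power3_eq_cube

definition cubic :: "'a::field \<Rightarrow> 'a \<Rightarrow> 'a \<Rightarrow> 'a \<Rightarrow> 'a" where
  "cubic a b c x = x ^ 3 + a * x\<^sup>2 + b * x + c"

definition cubic_curve :: "'a::field \<Rightarrow> 'a \<Rightarrow> 'a \<Rightarrow> 'a weierstrass" where
  "cubic_curve a b c = \<lparr>wa1 = 0, wa2 = a, wa3 = 0, wa4 = b, wa6 = c\<rparr>"

lemma cubic_curve_simps [simp]:
  "wa1 (cubic_curve a b c) = 0" "wa2 (cubic_curve a b c) = a" "wa3 (cubic_curve a b c) = 0"
  "wa4 (cubic_curve a b c) = b" "wa6 (cubic_curve a b c) = c"
  by (simp_all add: cubic_curve_def)

fun xneg :: "'a::field ec_point \<Rightarrow> 'a ec_point" where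
  "xneg Infinity = Infinity"
| "xneg (Affine x y) = Affine x (- y)"

lemma xneg_xneg [simp]: "xneg (xneg P) = P"
  by (cases P) auto

locale nonsingular_cubic =
  fixes a b c :: "'a::{field_char_0, alg_closed_field}"
  assumes nonsingular: "cubic a b c x = 0 \<Longrightarrow> 3 * x\<^sup>2 + 2 * a * x + b \<noteq> 0"
begin

abbreviation f :: "'a \<Rightarrow> 'a" where "f \<equiv> cubic a b c"

abbreviation padd :: "'a ec_point \<Rightarrow> 'a ec_point \<Rightarrow> 'a ec_point" (infixl "\<boxplus>" 65) where
  "padd \<equiv> ec_add (cubic_curve a b c)"

abbreviation C :: "'a ec_point set" where "C \<equiv> ec_points (cubic_curve a b c) UNIV"

lemma Infinity_in_C [simp]: "Infinity \<in> C"
  by (simp add: ec_points_def)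

lemma Affine_in_C [simp]: "Affine x y \<in> C \<longleftrightarrow> y\<^sup>2 = f x"
  by (auto simp: ec_points_def cubic_def)

lemma xneg_in_C [simp]: "xneg P \<in> C \<longleftrightarrow> P \<in> C"
  by (cases P) auto

lemma padd_Infinity_right [simp]: "P \<boxplus> Infinity = P"
  by (cases P) auto

lemma padd_xneg [simp]: "P \<boxplus> xneg P = Infinity" "xneg P \<boxplus> P = Infinity"
  by (cases P; simp)+

text \<open>The slope is a parameter tied to the points by an equation, so that later identities
  about sums are polynomial and free of division.\<close>

lemma padd_chord:
  assumes "x1 \<noteq> x2" "y2 = y1 + l * (x2 - x1)" "x3 = l\<^sup>2 - a - x1 - x2"
  shows "Affine x1 y1 \<boxplus> Affine x2 y2 = Affine x3 (- (y1 + l * (x3 - x1)))"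
proof -
  have "(y2 - y1) / (x2 - x1) = l"
    using assms(1,2) by (simp add: field_simps)
  then show ?thesis
    using assms(1) unfolding assms(3) by (simp add: Let_def ring_normal)
qed

lemma padd_tangent:
  assumes "y \<noteq> 0" "3 * x\<^sup>2 + 2 * a * x + b = 2 * y * l" "x3 = l\<^sup>2 - a - x - x"
  shows "Affine x y \<boxplus> Affine x y = Affine x3 (- (y + l * (x3 - x)))"
proof -
  have "(3 * x\<^sup>2 + 2 * a * x + b) / (2 * y) = l"
    using assms(1,2) by (simp add: field_simps)
  moreover have "y + y \<noteq> 0"
    using assms(1) by (simp flip: mult_2)
  ultimately show ?thesis
    unfolding assms(3) by (simp add: Let_def ring_normal)
qed

text \<open>The factorization of the cubic minus the squared line is the real content: closure,
  cancellation and associativity are all read off from it, for chords and tangents alike.\<close>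

lemma padd_line:
  assumes P: "y1\<^sup>2 = f x1" and Q: "y2\<^sup>2 = f x2" and ne: "\<not> (x1 = x2 \<and> y1 + y2 = 0)"
  obtains l x3 where "x3 = l\<^sup>2 - a - x1 - x2" "y2 = y1 + l * (x2 - x1)"
    "Affine x1 y1 \<boxplus> Affine x2 y2 = Affine x3 (- (y1 + l * (x3 - x1)))"
    "\<And>x. f x - (y1 + l * (x - x1))\<^sup>2 = (x - x1) * (x - x2) * (x - x3)"
    "x1 = x2 \<Longrightarrow> 3 * x1\<^sup>2 + 2 * a * x1 + b = 2 * y1 * l"
proof (cases "x1 = x2")
  case False
  define l where "l = (y2 - y1) / (x2 - x1)"
  have y2: "y2 = y1 + l * (x2 - x1)"
    using False by (simp add: l_def)
  define x3 where "x3 = l\<^sup>2 - a - x1 - x2"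
  have "f x - (y1 + l * (x - x1))\<^sup>2 = (x - x1) * (x - x2) * (x - x3)" for x
  proof -
    \<comment> \<open>With \<open>x3\<close> chosen by Vieta the difference is linear in
      \<open>x\<close>, hence given by Lagrange interpolation at \<open>x1\<close> and
      \<open>x2\<close>; the factor \<open>x2 - x1\<close> clears the denominator.\<close>
    have "(x2 - x1) * (f x - (y1 + l * (x - x1))\<^sup>2 - (x - x1) * (x - x2) * (x - x3))
        = (f x1 - y1\<^sup>2) * (x2 - x) + (f x2 - (y1 + l * (x2 - x1))\<^sup>2) * (x - x1)"
      unfolding x3_def cubic_def by (simp add: ring_normal)
    then show ?thesis using False P Q y2 by simp
  qed
  then show ?thesis
    using that[OF x3_def y2 padd_chord[OF False y2 x3_def]] False by blast
next
  case True
  have "(y2 - y1) * (y2 + y1) = 0"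
    using P Q True by (simp add: algebra_simps power2_eq_square)
  then have eq: "y2 = y1" using ne True by (auto simp: add.commute)
  then have y1: "y1 \<noteq> 0" using ne True by auto
  define l where "l = (3 * x1\<^sup>2 + 2 * a * x1 + b) / (2 * y1)"
  have l: "3 * x1\<^sup>2 + 2 * a * x1 + b = 2 * y1 * l"
    using y1 by (simp add: l_def)
  define x3 where "x3 = l\<^sup>2 - a - x1 - x2"
  have "f x - (y1 + l * (x - x1))\<^sup>2 = (x - x1) * (x - x2) * (x - x3)" for x
  proof -
    have "f x - (y1 + l * (x - x1))\<^sup>2 - (x - x1) * (x - x1) * (x - (l\<^sup>2 - a - x1 - x1))
        = (f x1 - y1\<^sup>2) + ((3 * x1\<^sup>2 + 2 * a * x1 + b) - 2 * y1 * l) * (x - x1)"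
      unfolding cubic_def by (simp add: ring_normal)
    then show ?thesis using P l True x3_def by simp
  qed
  then show ?thesis
    using that[OF x3_def _ _ _ l] padd_tangent[OF y1 l] x3_def eq True by simp
qed

text \<open>The derivative of both sides at the root \<open>p\<close>, taken by a central
  difference: for a monic cubic the difference of the values at \<open>p + 1\<close> and
  \<open>p - 1\<close> is twice the derivative at \<open>p\<close> plus 2.\<close>

lemma cubic_deriv_of_factorization:
  assumes "\<And>x. f x - (v + l * (x - u))\<^sup>2 = (x - p) * (x - q) * (x - r)"
  shows "3 * p\<^sup>2 + 2 * a * p + b - 2 * (v + l * (p - u)) * l = (p - q) * (p - r)"
proof -
  have "2 * (3 * p\<^sup>2 + 2 * a * p + b - 2 * (v + l * (p - u)) * l) + 2
      = (f (p + 1) - (v + l * ((p + 1) - u))\<^sup>2) - (f (p - 1) - (v + l * ((p - 1) - u))\<^sup>2)"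
    unfolding cubic_def by (simp add: ring_normal)
  also have "\<dots> = 2 * ((p - q) * (p - r)) + 2"
    unfolding assms by (simp add: ring_normal)
  finally show ?thesis
    unfolding add_right_cancel mult_cancel_left by simp
qed

lemma padd_in_C:
  assumes "P \<in> C" "Q \<in> C"
  shows "P \<boxplus> Q \<in> C"
proof (cases P; cases Q)
  fix x1 y1 x2 y2 assume PQ: "P = Affine x1 y1" "Q = Affine x2 y2"
  show ?thesis
  proof (cases "x1 = x2 \<and> y1 + y2 = 0")
    case False
    then obtain l x3 where "P \<boxplus> Q = Affine x3 (- (y1 + l * (x3 - x1)))"
      "\<And>x. f x - (y1 + l * (x - x1))\<^sup>2 = (x - x1) * (x - x2) * (x - x3)"
      using padd_line[of y1 x1 y2 x2] assms unfolding PQ Affine_in_C by metis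
    from this(1) this(2)[of x3] show ?thesis by (simp del: ec_add.simps minus_add_distrib)
  qed (use PQ in auto)
qed (use assms in auto)

lemma padd_commute:
  assumes "P \<in> C" "Q \<in> C"
  shows "P \<boxplus> Q = Q \<boxplus> P"
proof (cases P; cases Q)
  fix x1 y1 x2 y2 assume PQ: "P = Affine x1 y1" "Q = Affine x2 y2"
  show ?thesis
  proof (cases "x1 = x2")
    case True
    have "(y2 - y1) * (y2 + y1) = 0"
      using assms PQ True by (simp add: algebra_simps power2_eq_square)
    then show ?thesis using True PQ by (auto simp: add.commute)
  next
    case False
    then obtain l where l: "y2 = y1 + l * (x2 - x1)"
      by (metis diff_add_cancel add.commute nonzero_divide_eq_eq right_minus_eq)
    then have l': "y1 = y2 + l * (x1 - x2)"
      by (simp add: algebra_simps)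
    show ?thesis
      unfolding PQ padd_chord[OF False l refl] padd_chord[OF False[symmetric] l' refl]
      by (simp add: l algebra_simps)
  qed
qed auto

text \<open>The one instance of associativity that is proved first: it gives cancellation, which the
  general case then relies on.\<close>

lemma padd_xneg_cancel:
  assumes "P \<in> C" "Q \<in> C"
  shows "(P \<boxplus> Q) \<boxplus> xneg Q = P"
proof (cases P; cases Q)
  fix x1 y1 x2 y2 assume PQ: "P = Affine x1 y1" "Q = Affine x2 y2"
  show ?thesis
  proof (cases "x1 = x2 \<and> y1 + y2 = 0")
    case True
    then show ?thesis
      using PQ by (simp add: add_eq_0_iff)
  next
    case False
    then obtain l x3 where l: "x3 = l\<^sup>2 - a - x1 - x2" "y2 = y1 + l * (x2 - x1)"
      "P \<boxplus> Q = Affine x3 (- (y1 + l * (x3 - x1)))"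
      "\<And>x. f x - (y1 + l * (x - x1))\<^sup>2 = (x - x1) * (x - x2) * (x - x3)"
      "x1 = x2 \<Longrightarrow> 3 * x1\<^sup>2 + 2 * a * x1 + b = 2 * y1 * l"
      using padd_line[of y1 x1 y2 x2] assms unfolding PQ Affine_in_C by metis
    show ?thesis
    proof (cases "x3 = x2")
      case False
      have s: "- y2 = - (y1 + l * (x3 - x1)) + (- l) * (x2 - x3)" "x1 = (- l)\<^sup>2 - a - x3 - x2"
        by (simp_all add: l(1,2) algebra_simps)
      have "Affine x3 (- (y1 + l * (x3 - x1))) \<boxplus> Affine x2 (- y2) = Affine x1 y1"
        unfolding padd_chord[OF False s] by (simp add: algebra_simps)
      then show ?thesis
        unfolding l(3) unfolding PQ by (simp del: ec_add.simps)
    next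
      case True
      \<comment> \<open>The line is tangent at \<open>Q\<close>, so \<open>P \<boxplus> Q\<close> is
        \<open>xneg Q\<close> and the claim concerns doubling \<open>xneg Q\<close>. Nonsingularity
        enters here: if \<open>y2\<close> were 0, then \<open>x2\<close> would be a double root of
        \<open>f\<close>.\<close>
      have tan: "3 * x2\<^sup>2 + 2 * a * x2 + b = 2 * y2 * l"
      proof (cases "x1 = x2")
        case True then show ?thesis using l by simp
      next
        case False
        have "f x - (y1 + l * (x - x1))\<^sup>2 = (x - x2) * (x - x2) * (x - x1)" for x
          using l(4)[of x] True by (simp add: ac_simps)
        from cubic_deriv_of_factorization[OF this] show ?thesis
          using l(2) by simp
      qed
      have y2: "y2 \<noteq> 0"
        using tan nonsingular[of x2] assms(2) PQ by auto
      have e: "- (y1 + l * (x3 - x1)) = - y2" using True l(2) by simp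
      have s: "- y2 \<noteq> 0" "3 * x2\<^sup>2 + 2 * a * x2 + b = 2 * (- y2) * (- l)"
          "x1 = (- l)\<^sup>2 - a - x2 - x2"
        using y2 tan l(1) True by simp_all
      have "Affine x2 (- y2) \<boxplus> Affine x2 (- y2) = Affine x1 y1"
        unfolding padd_tangent[OF s] by (simp add: l(2) algebra_simps)
      then show ?thesis
        unfolding l(3) unfolding e unfolding True PQ by (simp del: ec_add.simps)
    qed
  qed
qed (use assms in auto)

lemma padd_cancel:
  assumes "P \<in> C" "Q \<in> C" "R \<in> C" "P \<boxplus> R = Q \<boxplus> R"
  shows "P = Q"
  using padd_xneg_cancel[of P R] padd_xneg_cancel[of Q R] assms by metis

lemma padd_assoc_affine:
  assumes P: "y1\<^sup>2 = f x1" and Q: "y2\<^sup>2 = f x2" and R: "y3\<^sup>2 = f x3"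
    and PQ: "Affine x1 y1 \<boxplus> Affine x2 y2 = Affine x12 y12" "x12 \<noteq> x3"
    and QR: "Affine x2 y2 \<boxplus> Affine x3 y3 = Affine x23 y23" "x23 \<noteq> x1"
    and ne: "x3 \<noteq> x1" "x3 \<noteq> x2"
  shows "(Affine x1 y1 \<boxplus> Affine x2 y2) \<boxplus> Affine x3 y3 = Affine x1 y1 \<boxplus> (Affine x2 y2 \<boxplus> Affine x3 y3)"
proof -
  have "\<not> (x1 = x2 \<and> y1 + y2 = 0)" using PQ by auto
  then obtain l z where l: "z = l\<^sup>2 - a - x1 - x2" "y2 = y1 + l * (x2 - x1)"
      "Affine x1 y1 \<boxplus> Affine x2 y2 = Affine z (- (y1 + l * (z - x1)))"
      "\<And>x. f x - (y1 + l * (x - x1))\<^sup>2 = (x - x1) * (x - x2) * (x - z)"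
      "x1 = x2 \<Longrightarrow> 3 * x1\<^sup>2 + 2 * a * x1 + b = 2 * y1 * l"
    using padd_line[OF P Q] by metis
  have "z = x12" "y12 = - (y1 + l * (x12 - x1))"
    using l(3) unfolding PQ(1) by auto
  note l = l(1,2)[unfolded this(1)] this(2) l(4,5)[unfolded this(1)]
  have "\<not> (x2 = x3 \<and> y2 + y3 = 0)" using QR by auto
  then obtain m z where m: "z = m\<^sup>2 - a - x2 - x3" "y3 = y2 + m * (x3 - x2)"
      "Affine x2 y2 \<boxplus> Affine x3 y3 = Affine z (- (y2 + m * (z - x2)))"
      "\<And>x. f x - (y2 + m * (x - x2))\<^sup>2 = (x - x2) * (x - x3) * (x - z)"
    using padd_line[OF Q R] by metis
  have "z = x23" "y23 = - (y2 + m * (x23 - x2))"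
    using m(3) unfolding QR(1) by auto
  note m = m(1,2)[unfolded this(1)] this(2) m(4)[unfolded this(1)]
  define \<alpha> where "\<alpha> = (m - l) / (x3 - x1)"
  have \<alpha>: "m = l + \<alpha> * (x3 - x1)"
    using ne by (simp add: \<alpha>_def)
  \<comment> \<open>\<open>\<alpha>\<close> is the leading coefficient of the parabola through the three points; its fourth
      intersection with the curve is symmetric in them.\<close>
  have y3: "y3 = y1 + l * (x3 - x1) + \<alpha> * (x3 - x1) * (x3 - x2)"
    unfolding m(2) l(2) \<alpha> by (simp add: algebra_simps)
  have "(x3 - x1) * (x3 - x2) * (\<alpha> * (y3 + (y1 + l * (x3 - x1))) - (x3 - x12))
      = (y3 - (y1 + l * (x3 - x1))) * (y3 + (y1 + l * (x3 - x1))) - (x3 - x1) * (x3 - x2) * (x3 - x12)"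
    by (subst (2) y3) (simp add: ring_normal)
  also have "\<dots> = 0"
    unfolding l(4)[of x3, symmetric] R[symmetric] by (simp add: ring_normal)
  finally have "(x3 - x1) * (x3 - x2) * (\<alpha> * (y3 + (y1 + l * (x3 - x1))) - (x3 - x12)) = 0" .
  then have e1: "\<alpha> * (y3 + (y1 + l * (x3 - x1))) = x3 - x12"
    using ne by simp
  then have \<alpha>0: "\<alpha> \<noteq> 0" using PQ(2) by auto
  \<comment> \<open>The mirror image of \<open>e1\<close>, with the line through the second and
    third point evaluated at the first. For \<open>x1 = x2\<close> the division by
    \<open>x1 - x2\<close> is impossible, and the derivative of the factorization at the common root
    takes its place.\<close>
  have e2: "\<alpha> * (y1 + (y2 + m * (x1 - x2))) = x1 - x23"
  proof (cases "x1 = x2")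
    case False
    have y1: "y1 = y2 + m * (x1 - x2) + \<alpha> * (x1 - x2) * (x1 - x3)"
      unfolding l(2) \<alpha> by (simp add: algebra_simps)
    have "(x1 - x2) * (x1 - x3) * (\<alpha> * (y1 + (y2 + m * (x1 - x2))) - (x1 - x23))
        = (y1 - (y2 + m * (x1 - x2))) * (y1 + (y2 + m * (x1 - x2))) - (x1 - x2) * (x1 - x3) * (x1 - x23)"
      by (subst (2) y1) (simp add: ring_normal)
    also have "\<dots> = 0"
      unfolding m(4)[of x1, symmetric] P[symmetric] by (simp add: ring_normal)
    finally have "(x1 - x2) * (x1 - x3) * (\<alpha> * (y1 + (y2 + m * (x1 - x2))) - (x1 - x23)) = 0" .
    then show ?thesis using False ne by simp
  next
    case True
    have y: "y2 = y1" using True l(2) by simp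
    have "3 * x2\<^sup>2 + 2 * a * x2 + b - 2 * y2 * m = (x2 - x3) * (x2 - x23)"
      using cubic_deriv_of_factorization[OF m(4)] by simp
    moreover have "3 * x2\<^sup>2 + 2 * a * x2 + b = 2 * y2 * l"
      using l(5)[OF True] True y by simp
    ultimately have "2 * y2 * l - 2 * y2 * m = (x2 - x3) * (x2 - x23)"
      by simp
    then have "2 * y1 * (l - m) = (x1 - x3) * (x1 - x23)"
      using True y by (simp add: right_diff_distrib)
    moreover have "2 * y1 * (l - m) = (x1 - x3) * (\<alpha> * (y1 + y1))"
      unfolding \<alpha> by (simp add: ring_normal)
    ultimately show ?thesis using ne True y by simp
  qed
  \<comment> \<open>By \<open>e1\<close> and \<open>e2\<close> these are the slopes of the two outer
    chords, from the first sum to the third point and from the first point to the second sum;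
    \<open>c1\<close> and \<open>c2\<close> confirm it. What remains is that the two chord formulas
    agree.\<close>
  define n where "n = 1 / \<alpha> - l"
  define n' where "n' = 1 / \<alpha> - m"
  have an: "\<alpha> * n = 1 - \<alpha> * l" "\<alpha> * n' = 1 - \<alpha> * m"
    using \<alpha>0 by (simp_all add: n_def n'_def algebra_simps)
  have "\<alpha> * (y3 - (y12 + n * (x3 - x12))) = \<alpha> * y3 - \<alpha> * y12 - (\<alpha> * n) * (x3 - x12)"
    by (simp add: ring_normal)
  also have "\<dots> = \<alpha> * (y3 + (y1 + l * (x3 - x1))) - (x3 - x12)"
    unfolding an l(3) by (simp add: ring_normal)
  finally have c1: "y3 = y12 + n * (x3 - x12)" using \<alpha>0 e1 by simp
  have "\<alpha> * (y23 - (y1 + n' * (x23 - x1))) = \<alpha> * y23 - \<alpha> * y1 - (\<alpha> * n') * (x23 - x1)"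
    by (simp add: ring_normal)
  also have "\<dots> = (x1 - x23) - \<alpha> * (y1 + (y2 + m * (x1 - x2)))"
    unfolding an m(3) by (simp add: ring_normal)
  finally have c2: "y23 = y1 + n' * (x23 - x1)" using \<alpha>0 e2 by simp
  have nn: "n = n' + \<alpha> * (x3 - x1)"
    unfolding n_def n'_def by (simp add: \<alpha>)
  have "n\<^sup>2 - n'\<^sup>2 = (\<alpha> * n + \<alpha> * n') * (x3 - x1)"
    unfolding nn by (simp add: ring_normal)
  also have "\<dots> = 2 * (x3 - x1) - (\<alpha> * (x3 - x1)) * (l + m)"
    unfolding an by (simp add: ring_normal)
  also have "\<alpha> * (x3 - x1) = m - l"
    unfolding \<alpha> by simp
  finally have "n\<^sup>2 - n'\<^sup>2 = 2 * (x3 - x1) - (m - l) * (l + m)" .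
  then have X: "n\<^sup>2 - a - x12 - x3 = n'\<^sup>2 - a - x1 - x23"
    unfolding l(1) m(1) by (simp add: algebra_simps power2_eq_square)
  define x where "x = n\<^sup>2 - a - x12 - x3"
  have "\<alpha> * x = (\<alpha> * n + \<alpha> * l) * (n - l) + \<alpha> * (x1 + x2 - x3)"
    unfolding x_def l(1) by (simp add: ring_normal)
  also have "\<dots> = n - l + \<alpha> * (x1 + x2 - x3)"
    unfolding an by (simp add: ring_normal)
  finally have ax: "\<alpha> * x = n - l + \<alpha> * (x1 + x2 - x3)" .
  have "y12 + n * (x - x12) = y3 + n * (x - x3)"
    unfolding c1 by (simp add: ring_normal)
  also have "\<dots> = y1 + n' * (x - x1) + (x3 - x1) * (\<alpha> * x - (n - l + \<alpha> * (x1 + x2 - x3)))"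
    unfolding y3 nn by (simp add: ring_normal)
  finally have Y: "y12 + n * (x - x12) = y1 + n' * (x - x1)"
    unfolding ax by simp
  show ?thesis
    unfolding PQ(1) QR(1) padd_chord[OF PQ(2) c1 refl] padd_chord[OF QR(2)[symmetric] c2 refl]
    unfolding X[symmetric] x_def[symmetric] Y ..
qed

lemma padd_xneg_cancel_left:
  assumes "P \<in> C" "Q \<in> C"
  shows "xneg P \<boxplus> (P \<boxplus> Q) = Q"
  using padd_xneg_cancel[of Q P] assms by (simp add: padd_commute padd_in_C)

text \<open>The points \<open>R\<close> for which a sum involving \<open>R\<close> may leave the
  chord case. \<open>R = \<plusminus>(P + Q)\<close> spoils the outer sum on the left of the
  associative law, and \<open>R = \<plusminus>P - Q\<close>, that is
  \<open>Q + R = \<plusminus>P\<close>, the outer sum on the right.\<close>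

definition exceptional :: "'a ec_point \<Rightarrow> 'a ec_point \<Rightarrow> 'a ec_point set" where
  "exceptional P Q = {Infinity, P, xneg P, Q, xneg Q, P \<boxplus> Q, xneg (P \<boxplus> Q),
     P \<boxplus> xneg Q, xneg P \<boxplus> xneg Q}"

lemma finite_exceptional: "finite (exceptional P Q)"
  by (simp add: exceptional_def)

lemma same_x_cases:
  assumes "Affine x y \<in> C" "Affine x y' \<in> C"
  shows "Affine x y = Affine x y' \<or> Affine x y = xneg (Affine x y')"
  using assms power2_eq_iff[of y y'] by auto

lemma padd_assoc_generic:
  assumes "P \<in> C" "Q \<in> C" "R \<in> C" "R \<notin> exceptional P Q"
  shows "(P \<boxplus> Q) \<boxplus> R = P \<boxplus> (Q \<boxplus> R)"
proof (cases "P = Infinity \<or> Q = Infinity \<or> Q = xneg P")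
  case True
  then show ?thesis
    using assms padd_xneg_cancel_left[of "xneg P" R] by auto
next
  case False
  then obtain x1 y1 x2 y2 where PQ: "P = Affine x1 y1" "Q = Affine x2 y2"
    by (meson ec_point.exhaust)
  from assms(4) obtain x3 y3 where R: "R = Affine x3 y3"
    by (cases R) (auto simp: exceptional_def)
  have on: "y1\<^sup>2 = f x1" "y2\<^sup>2 = f x2" "y3\<^sup>2 = f x3"
    using assms PQ R by auto
  have ne: "x3 \<noteq> x1" "x3 \<noteq> x2"
    using assms(4) same_x_cases[of x3 y3 y1] same_x_cases[of x3 y3 y2] on
    unfolding PQ R exceptional_def by auto
  have "\<not> (x1 = x2 \<and> y1 + y2 = 0)"
    using False PQ by (auto simp: add_eq_0_iff)
  then obtain x12 y12 where S: "P \<boxplus> Q = Affine x12 y12"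
    using padd_line[OF on(1,2)] unfolding PQ by metis
  obtain x23 y23 where T: "Q \<boxplus> R = Affine x23 y23"
    using padd_line[OF on(2,3)] ne unfolding PQ R by metis
  have "x12 \<noteq> x3"
    using assms(4) same_x_cases[of x3 y3 y12] on padd_in_C[OF assms(1,2)] R
    unfolding S exceptional_def by auto
  moreover have "x23 \<noteq> x1"
  proof
    assume eq: "x23 = x1"
    have "Affine x1 y23 \<in> C" using padd_in_C[OF assms(2,3)] unfolding T eq .
    with on(1) have "Q \<boxplus> R = P \<or> Q \<boxplus> R = xneg P"
      using same_x_cases[of x1 y23 y1] unfolding T eq unfolding PQ by simp
    moreover have "R = (Q \<boxplus> R) \<boxplus> xneg Q"
      using padd_xneg_cancel_left[OF assms(2,3)] assms by (simp add: padd_commute padd_in_C)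
    ultimately show False
      using assms(4) unfolding exceptional_def by auto
  qed
  ultimately show ?thesis
    using padd_assoc_affine[OF on S[unfolded PQ] _ T[unfolded PQ R] _ ne] unfolding PQ R by blast
qed

lemma infinite_C: "infinite C"
proof
  assume "finite C"
  define g where "g = (\<lambda>P :: 'a ec_point. case P of Infinity \<Rightarrow> 0 | Affine x y \<Rightarrow> x)"
  have "x \<in> g ` C" for x
  proof -
    obtain y where "y\<^sup>2 = f x"
      using nth_root_exists[of 2 "f x"] by auto
    then show ?thesis
      by (intro image_eqI[of _ _ "Affine x y"]) (auto simp: g_def)
  qed
  then have "finite (UNIV :: 'a set)"
    using finite_surj[OF \<open>finite C\<close>, of UNIV g] by blast
  then show False
    using infinite_UNIV_char_0 by blast
qed

lemma padd_assoc:
  assumes [simp]: "P \<in> C" "Q \<in> C" "R \<in> C"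
  shows "(P \<boxplus> Q) \<boxplus> R = P \<boxplus> (Q \<boxplus> R)"
proof -
  \<comment> \<open>Adding a generic point to both sides avoids all degenerate cases.\<close>
  define bad where "bad = exceptional (P \<boxplus> Q) R \<union> padd (xneg R) ` exceptional P Q
     \<union> exceptional Q R \<union> exceptional P (Q \<boxplus> R)"
  have "finite bad"
    by (simp add: bad_def finite_exceptional)
  then obtain T where T[simp]: "T \<in> C" and nb: "T \<notin> bad"
    using infinite_C by (meson finite_subset subsetI)
  have RT: "R \<boxplus> T \<notin> exceptional P Q"
    using nb padd_xneg_cancel_left[of R T] unfolding bad_def by force
  note [simp] = padd_in_C
  have "((P \<boxplus> Q) \<boxplus> R) \<boxplus> T = (P \<boxplus> Q) \<boxplus> (R \<boxplus> T)"
    by (rule padd_assoc_generic) (use nb in \<open>auto simp: bad_def\<close>)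
  also have "\<dots> = P \<boxplus> (Q \<boxplus> (R \<boxplus> T))"
    by (rule padd_assoc_generic) (use RT in auto)
  also have "Q \<boxplus> (R \<boxplus> T) = (Q \<boxplus> R) \<boxplus> T"
    by (rule padd_assoc_generic[symmetric]) (use nb in \<open>auto simp: bad_def\<close>)
  also have "P \<boxplus> ((Q \<boxplus> R) \<boxplus> T) = (P \<boxplus> (Q \<boxplus> R)) \<boxplus> T"
    by (rule padd_assoc_generic[symmetric]) (use nb in \<open>auto simp: bad_def\<close>)
  finally show ?thesis
    by (rule padd_cancel[rotated 3]) auto
qed

end

section \<open>From general Weierstrass equations to monic cubics\<close>

definition square_completed :: "'a::field weierstrass \<Rightarrow> 'a weierstrass" where
  "square_completed E = cubic_curve (wa2 E + (wa1 E)\<^sup>2 / 4) (wa4 E + wa1 E * wa3 E / 2)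
     (wa6 E + (wa3 E)\<^sup>2 / 4)"

fun complete_square :: "'a::field weierstrass \<Rightarrow> 'a ec_point \<Rightarrow> 'a ec_point" where
  "complete_square E Infinity = Infinity"
| "complete_square E (Affine x y) = Affine x (y + (wa1 E * x + wa3 E) / 2)"

lemma complete_square_inject [simp]:
  "complete_square E P = complete_square E Q \<longleftrightarrow> P = Q"
  by (cases P; cases Q) auto

text \<open>The discriminant of \<open>E\<close> is 16 times that of the cubic. A double root
  \<open>x\<close> forces the cubic to be \<open>(X - x)^2 * (X + 2 * x + a)\<close>; this
  determines \<open>b\<close> and \<open>c\<close> from \<open>a\<close> and \<open>x\<close>, and
  the discriminant then vanishes identically.\<close>

lemma square_completed_nonsingular:
  fixes E :: "'a::{field_char_0, alg_closed_field} weierstrass"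
  assumes "discriminant E \<noteq> 0"
  shows "nonsingular_cubic (wa2 E + (wa1 E)\<^sup>2 / 4) (wa4 E + wa1 E * wa3 E / 2)
     (wa6 E + (wa3 E)\<^sup>2 / 4)"
proof
  fix x
  define a b c where abc: "a = wa2 E + (wa1 E)\<^sup>2 / 4" "b = wa4 E + wa1 E * wa3 E / 2"
     "c = wa6 E + (wa3 E)\<^sup>2 / 4"
  have disc: "discriminant E
      = 16 * (a\<^sup>2 * b\<^sup>2 - 4 * b ^ 3 - 4 * a ^ 3 * c - 27 * c\<^sup>2 + 18 * a * b * c)"
    unfolding discriminant_def Let_def abc
    by (simp add: field_simps power2_eq_square power3_eq_cube)
  assume 0: "cubic a b c x = 0"
  show "3 * x\<^sup>2 + 2 * a * x + b \<noteq> 0"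
  proof
    assume "3 * x\<^sup>2 + 2 * a * x + b = 0"
    then have b: "b = - 3 * x\<^sup>2 - 2 * a * x"
      by (simp add: add_eq_0_iff)
    have "c = - (x ^ 3 + a * x\<^sup>2 + b * x)"
      using 0 by (simp add: cubic_def add_eq_0_iff)
    also have "\<dots> = 2 * x ^ 3 + a * x\<^sup>2"
      unfolding b by (simp add: ring_normal)
    finally have c: "c = 2 * x ^ 3 + a * x\<^sup>2" .
    show False
      using assms unfolding disc b c by (simp add: ring_normal)
  qed
qed

lemma complete_square_in_ec_points [simp]:
  fixes E :: "'a::field_char_0 weierstrass"
  shows "complete_square E P \<in> ec_points (square_completed E) UNIV \<longleftrightarrow> P \<in> ec_points E UNIV"
proof (cases P)
  case (Affine x y)
  have "(y + (wa1 E * x + wa3 E) / 2)\<^sup>2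
      - (x ^ 3 + (wa2 E + (wa1 E)\<^sup>2 / 4) * x\<^sup>2 + (wa4 E + wa1 E * wa3 E / 2) * x
         + (wa6 E + (wa3 E)\<^sup>2 / 4))
      = y\<^sup>2 + wa1 E * x * y + wa3 E * y - (x ^ 3 + wa2 E * x\<^sup>2 + wa4 E * x + wa6 E)"
    by (simp add: field_simps power2_eq_square power3_eq_cube)
  then have "(y + (wa1 E * x + wa3 E) / 2)\<^sup>2
      = x ^ 3 + (wa2 E + (wa1 E)\<^sup>2 / 4) * x\<^sup>2 + (wa4 E + wa1 E * wa3 E / 2) * x
         + (wa6 E + (wa3 E)\<^sup>2 / 4)
    \<longleftrightarrow> y\<^sup>2 + wa1 E * x * y + wa3 E * y = x ^ 3 + wa2 E * x\<^sup>2 + wa4 E * x + wa6 E"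
    by (rule diff_eq_diff_eq)
  then show ?thesis
    unfolding Affine ec_points_def square_completed_def by simp
qed (simp add: ec_points_def)

lemma complete_square_add:
  fixes E :: "'a::field_char_0 weierstrass"
  assumes "P \<in> ec_points E UNIV" "Q \<in> ec_points E UNIV"
  shows "complete_square E (ec_add E P Q)
    = ec_add (square_completed E) (complete_square E P) (complete_square E Q)"
proof (cases P; cases Q)
  fix x1 y1 x2 y2 assume PQ: "P = Affine x1 y1" "Q = Affine x2 y2"
  define y1' y2' where y': "y1' = y1 + (wa1 E * x1 + wa3 E) / 2" "y2' = y2 + (wa1 E * x2 + wa3 E) / 2"
  have "y1' + y2' = y1 + y2 + wa1 E * x2 + wa3 E" if "x1 = x2"
    using that by (simp add: y' field_simps)
  then have inf: "x1 = x2 \<and> y1' + y2' = 0 \<longleftrightarrow> x1 = x2 \<and> y1 + y2 + wa1 E * x2 + wa3 E = 0"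
    by metis
  show ?thesis
  proof (cases "x1 = x2 \<and> y1 + y2 + wa1 E * x2 + wa3 E = 0")
    case True
    then show ?thesis
      using inf unfolding PQ by (simp add: square_completed_def y')
  next
    case False
    define l where "l = (if x1 = x2
                   then (3 * x1\<^sup>2 + 2 * wa2 E * x1 + wa4 E - wa1 E * y1)
                          / (2 * y1 + wa1 E * x1 + wa3 E)
                   else (y2 - y1) / (x2 - x1))"
    \<comment> \<open>The shift of \<open>y\<close> by \<open>(wa1 E * x + wa3 E) / 2\<close> has
      slope \<open>wa1 E / 2\<close>, so every chord and tangent slope grows by that amount.\<close>
    have l: "(if x1 = x2
         then (3 * x1\<^sup>2 + 2 * (wa2 E + (wa1 E)\<^sup>2 / 4) * x1 + (wa4 E + wa1 E * wa3 E / 2)) / (2 * y1')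
         else (y2' - y1') / (x2 - x1)) = l + wa1 E / 2"
    proof (cases "x1 = x2")
      case True
      have "y1\<^sup>2 + wa1 E * x2 * y1 + wa3 E * y1 = y2\<^sup>2 + wa1 E * x2 * y2 + wa3 E * y2"
        using assms True unfolding PQ ec_points_def by simp
      then have "(y1 - y2) * (y1 + y2 + wa1 E * x2 + wa3 E) = 0"
        by (simp add: ring_normal)
      then have "y1 = y2" using False True by simp
      then have "2 * y1 + wa1 E * x1 + wa3 E \<noteq> 0" "y1' \<noteq> 0"
        using False True by (auto simp: y' field_simps)
      moreover have y1': "2 * y1' = 2 * y1 + wa1 E * x1 + wa3 E" by (simp add: y' field_simps)
      moreover have "3 * x1\<^sup>2 + 2 * (wa2 E + (wa1 E)\<^sup>2 / 4) * x1 + (wa4 E + wa1 E * wa3 E / 2)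
          = (3 * x1\<^sup>2 + 2 * wa2 E * x1 + wa4 E - wa1 E * y1)
            + wa1 E / 2 * (2 * y1 + wa1 E * x1 + wa3 E)"
        by (simp add: field_simps power2_eq_square)
      ultimately show ?thesis
        using True unfolding l_def by (simp only: if_True add_divide_distrib y1') (simp only: nonzero_mult_div_cancel_right if_True simp_thms)
    next
      case False
      then show ?thesis
        unfolding l_def y' by (simp add: field_simps)
    qed
    have "complete_square E (ec_add E P Q) = (let x3 = l\<^sup>2 + wa1 E * l - wa2 E - x1 - x2
        in Affine x3 (- (l + wa1 E) * x3 - (y1 - l * x1) - wa3 E + (wa1 E * x3 + wa3 E) / 2))"
      using False unfolding PQ l_def by (simp add: Let_def)
    also have "\<dots> = (let k = l + wa1 E / 2; x3 = k\<^sup>2 - (wa2 E + (wa1 E)\<^sup>2 / 4) - x1 - x2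
        in Affine x3 (- k * x3 - (y1' - k * x1)))"
      unfolding y' by (simp add: Let_def field_simps power2_eq_square)
    also have "\<dots> = ec_add (square_completed E) (Affine x1 y1') (Affine x2 y2')"
      using False inf unfolding l[symmetric] square_completed_def by (simp add: Let_def)
    finally show ?thesis
      unfolding PQ by (simp add: y')
  qed
qed auto

fun ec_neg :: "'a::field weierstrass \<Rightarrow> 'a ec_point \<Rightarrow> 'a ec_point" where
  "ec_neg E Infinity = Infinity"
| "ec_neg E (Affine x y) = Affine x (- y - wa1 E * x - wa3 E)"

lemma ec_points_iff:
  "P \<in> ec_points E L \<longleftrightarrow> P \<in> ec_points E UNIV \<and>
     (\<forall>x y. P = Affine x y \<longrightarrow> x \<in> L \<and> y \<in> L)"
  by (auto simp: ec_points_def)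

lemma subfield_closed:
  assumes "is_subfield (L :: 'a::field_char_0 set)"
  shows "0 \<in> L" "1 \<in> L" "numeral k \<in> L" "of_nat n \<in> L"
    "x \<in> L \<Longrightarrow> y \<in> L \<Longrightarrow> x + y \<in> L" "x \<in> L \<Longrightarrow> y \<in> L \<Longrightarrow> x - y \<in> L"
    "x \<in> L \<Longrightarrow> y \<in> L \<Longrightarrow> x * y \<in> L" "x \<in> L \<Longrightarrow> y \<in> L \<Longrightarrow> x / y \<in> L"
    "x \<in> L \<Longrightarrow> - x \<in> L" "x \<in> L \<Longrightarrow> inverse x \<in> L" "x \<in> L \<Longrightarrow> x ^ n \<in> L"
proof -
  note L = assms[unfolded is_subfield_iff]
  show nat: "of_nat n \<in> L" for n
    by (induction n) (use L in auto)
  show "numeral k \<in> L"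
    using nat[of "numeral k"] by simp
  show "x \<in> L \<Longrightarrow> x ^ n \<in> L"
    by (induction n) (use L in auto)
  show "x \<in> L \<Longrightarrow> y \<in> L \<Longrightarrow> x - y \<in> L"
    using L by (metis add_uminus_conv_diff)
  show "x \<in> L \<Longrightarrow> y \<in> L \<Longrightarrow> x / y \<in> L"
    using L by (metis divide_inverse)
qed (use assms[unfolded is_subfield_iff] in auto)

text \<open>Lying on the curve is inherited from the completed cubic, whereas membership of the
  coordinates in \<open>L\<close> is read off from the addition formula.\<close>

lemma ec_add_in_ec_points:
  fixes E :: "'a::{field_char_0, alg_closed_field} weierstrass"
  assumes L: "is_subfield L" and E: "elliptic_curve_over L E"
    and "P \<in> ec_points E L" "Q \<in> ec_points E L"
  shows "ec_add E P Q \<in> ec_points E L"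
proof -
  interpret nonsingular_cubic "wa2 E + (wa1 E)\<^sup>2 / 4" "wa4 E + wa1 E * wa3 E / 2"
      "wa6 E + (wa3 E)\<^sup>2 / 4"
    using E square_completed_nonsingular[of E] by (simp add: elliptic_curve_over_def)
  have on: "P \<in> ec_points E UNIV" "Q \<in> ec_points E UNIV"
    using assms ec_points_iff by blast+
  have "complete_square E (ec_add E P Q) \<in> ec_points (square_completed E) UNIV"
    unfolding complete_square_add[OF on]
    using padd_in_C[folded square_completed_def] on by simp
  moreover have "x \<in> L \<and> y \<in> L" if "ec_add E P Q = Affine x y" for x y
  proof (cases P; cases Q)
    fix x1 y1 x2 y2 assume PQ: "P = Affine x1 y1" "Q = Affine x2 y2"
    then have "{x1, y1, x2, y2} \<subseteq> L"
      using assms ec_points_iff[of _ E L] by auto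
    then show ?thesis
      using that E unfolding PQ elliptic_curve_over_def
      by (auto simp: Let_def split: if_splits intro!: subfield_closed[OF L])
  qed (use that assms ec_points_iff[of _ E L] in auto)
  ultimately show ?thesis
    by (subst ec_points_iff) auto
qed

lemma ec_add_ec_neg: "ec_add E (ec_neg E P) P = Infinity"
  by (cases P) auto

lemma ec_neg_in_ec_points:
  fixes E :: "'a::field_char_0 weierstrass"
  assumes L: "is_subfield L" and E: "elliptic_curve_over L E" and P: "P \<in> ec_points E L"
  shows "ec_neg E P \<in> ec_points E L"
proof (cases P)
  case (Affine x y)
  let ?y = "- y - wa1 E * x - wa3 E"
  have "?y\<^sup>2 + wa1 E * x * ?y + wa3 E * ?y = y\<^sup>2 + wa1 E * x * y + wa3 E * y"
    by (simp add: ring_normal)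
  moreover have "?y \<in> L"
    using P E unfolding Affine elliptic_curve_over_def
    by (auto simp: ec_points_def intro!: subfield_closed[OF L])
  ultimately show ?thesis
    using P unfolding Affine ec_points_def by simp
qed (simp add: ec_points_def)

theorem comm_group_mordell_weil_group:
  fixes E :: "'a::{field_char_0, alg_closed_field} weierstrass"
  assumes L: "is_subfield L" and E: "elliptic_curve_over L E"
  shows "comm_group (mordell_weil_group E L)"
proof -
  interpret nonsingular_cubic "wa2 E + (wa1 E)\<^sup>2 / 4" "wa4 E + wa1 E * wa3 E / 2"
      "wa6 E + (wa3 E)\<^sup>2 / 4"
    using E square_completed_nonsingular[of E] by (simp add: elliptic_curve_over_def)
  note cl = ec_add_in_ec_points[OF L E]
  have cls: "complete_square E P \<in> C" if "P \<in> ec_points E L" for P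
    using complete_square_in_ec_points[of E P] that ec_points_iff[of P E L]
    unfolding square_completed_def by simp
  have add: "complete_square E (ec_add E P Q) = padd (complete_square E P) (complete_square E Q)"
    if "P \<in> ec_points E L" "Q \<in> ec_points E L" for P Q
    using complete_square_add[of P E Q] that ec_points_iff[of _ E L]
    unfolding square_completed_def by simp
  show ?thesis
    unfolding mordell_weil_group_def
  proof (rule comm_groupI, simp_all)
    show "Infinity \<in> ec_points E L" by (simp add: ec_points_def)
    fix P assume P: "P \<in> ec_points E L"
    show "\<exists>Q\<in>ec_points E L. ec_add E Q P = Infinity"
    proof
      show "ec_add E (ec_neg E P) P = Infinity"
        by (rule ec_add_ec_neg)
      show "ec_neg E P \<in> ec_points E L"
        by (rule ec_neg_in_ec_points[OF L E P])
    qed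
    fix Q assume Q: "Q \<in> ec_points E L"
    show "ec_add E P Q \<in> ec_points E L"
      by (rule cl[OF P Q])
    show "ec_add E P Q = ec_add E Q P"
      using add[OF P Q] add[OF Q P] padd_commute[OF cls[OF P] cls[OF Q]] by (metis complete_square_inject)
    fix R assume R: "R \<in> ec_points E L"
    \<comment> \<open>Associativity on the completed cubic pulls back along the injective map
      \<open>complete_square E\<close>.\<close>
    have "complete_square E (ec_add E (ec_add E P Q) R) = complete_square E (ec_add E P (ec_add E Q R))"
      using padd_assoc[OF cls[OF P] cls[OF Q] cls[OF R]] by (simp add: add P Q R cl)
    then show "ec_add E (ec_add E P Q) R = ec_add E P (ec_add E Q R)"
      by simp
  qed
qed

section \<open>Fixed fields of involutions and quadratic extensions\<close>

lemma complex_conjugationD: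
  fixes K :: "'a::field_char_0 set"
  assumes "complex_conjugation K \<sigma>"
  shows "\<sigma> (x + y) = \<sigma> x + \<sigma> y" "\<sigma> (x * y) = \<sigma> x * \<sigma> y" "\<sigma> (\<sigma> x) = x"
    "x \<in> K \<Longrightarrow> \<sigma> x = x" "\<exists>z. \<sigma> z \<noteq> z"
proof -
  have G: "group (Gal UNIV K)"
    by (rule group_Gal) (auto simp: is_subfield_iff)
  have \<sigma>: "\<sigma> \<in> carrier (Gal UNIV K)" and ord: "group.ord (Gal UNIV K) \<sigma> = 2"
    using assms by (auto simp: complex_conjugation_def)
  then have B: "\<sigma> \<in> Bij UNIV" by (simp add: Gal_def)
  show "\<sigma> (x + y) = \<sigma> x + \<sigma> y" "\<sigma> (x * y) = \<sigma> x * \<sigma> y" "x \<in> K \<Longrightarrow> \<sigma> x = x"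
    using \<sigma> by (auto simp: Gal_def)
  have one: "\<one>\<^bsub>Gal UNIV K\<^esub> = id"
    by (auto simp: Gal_def BijGroup_def)
  have "\<sigma> [^]\<^bsub>Gal UNIV K\<^esub> (2::nat) = \<one>\<^bsub>Gal UNIV K\<^esub>"
    using group.pow_ord_eq_1[OF G \<sigma>] ord by simp
  then have "\<sigma> \<otimes>\<^bsub>Gal UNIV K\<^esub> \<sigma> = id"
    using \<sigma> G by (simp add: numeral_2_eq_2 monoid.nat_pow_Suc monoid.nat_pow_0 one
        group.is_monoid monoid.l_one flip: one)
  then have "compose UNIV \<sigma> \<sigma> = id"
    using B by (simp add: Gal_def BijGroup_def)
  then show "\<sigma> (\<sigma> x) = x"
    by (metis UNIV_I compose_eq id_apply)
  have "\<sigma> \<noteq> id"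
    using ord group.ord_eq_1[OF G \<sigma>] one by auto
  then show "\<exists>z. \<sigma> z \<noteq> z" by auto
qed

locale involution =
  fixes \<sigma> :: "'a::{field_char_0, alg_closed_field} \<Rightarrow> 'a"
  assumes add: "\<sigma> (x + y) = \<sigma> x + \<sigma> y" and mult: "\<sigma> (x * y) = \<sigma> x * \<sigma> y"
    and invol: "\<sigma> (\<sigma> x) = x" and nontrivial: "\<exists>z. \<sigma> z \<noteq> z"
begin

lemma zero: "\<sigma> 0 = 0"
  using add[of 0 0] by simp

lemma one: "\<sigma> 1 = 1"
proof -
  have "\<sigma> 1 \<noteq> 0" using invol[of 1] zero by auto
  then show ?thesis using mult[of 1 1] by simp
qed

lemma uminus: "\<sigma> (- x) = - \<sigma> x"
  using add[of x "- x"] zero by (simp add: add_eq_0_iff)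

lemma diff: "\<sigma> (x - y) = \<sigma> x - \<sigma> y"
  using add[of x "- y"] uminus by simp

lemma inverse: "\<sigma> (inverse x) = inverse (\<sigma> x)"
proof (cases "x = 0")
  case False
  then have "\<sigma> (inverse x) * \<sigma> x = 1" using mult[of "inverse x" x] one by simp
  then show ?thesis by (metis inverse_unique mult.commute)
qed (simp add: zero)

lemma square_root_exists: "\<exists>w. w\<^sup>2 = (z::'a)"
  using nth_root_exists[of 2 z] by auto

text \<open>The Artin-Schreier argument: if \<open>\<sigma>\<close> fixed \<open>i\<close>, it would
  send a square root \<open>w\<close> of an element \<open>z\<close> with
  \<open>\<sigma> z = - z\<close> to \<open>\<plusminus>i w\<close>, and applying it twice would
  give \<open>- w\<close>.\<close>

lemma imaginary_unit:
  assumes i: "i\<^sup>2 = -1"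
  shows "\<sigma> i = - i"
proof (rule ccontr)
  assume ne: "\<sigma> i \<noteq> - i"
  have "(\<sigma> i)\<^sup>2 = i\<^sup>2"
    using mult[of i i] uminus[of 1] one i by (simp add: power2_eq_square)
  then have \<sigma>i: "\<sigma> i = i" using ne power2_eq_iff by blast
  obtain z0 where "\<sigma> z0 \<noteq> z0" using nontrivial by blast
  define z where "z = z0 - \<sigma> z0"
  have z: "z \<noteq> 0" "\<sigma> z = - z"
    using \<open>\<sigma> z0 \<noteq> z0\<close> by (auto simp: z_def diff invol)
  obtain w where w: "w\<^sup>2 = z" using square_root_exists by blast
  have "(\<sigma> w)\<^sup>2 = (i * w)\<^sup>2"
    using mult[of w w] w z(2) i by (simp add: power2_eq_square[symmetric] power_mult_distrib)
  then have "\<sigma> w = i * w \<or> \<sigma> w = - (i * w)" using power2_eq_iff by blast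
  then have "\<sigma> (\<sigma> w) = (i * i) * w"
    by (auto simp: uminus mult \<sigma>i)
  then have "w = - w" using i invol by (simp add: power2_eq_square)
  then have "w = 0" using eq_neg_iff_add_eq_0[of w w] by simp
  then show False using w z by simp
qed

text \<open>The nonnegative elements of the fixed field: in a real closed field these are exactly
  the squares.\<close>

definition nonneg :: "'a set" where
  "nonneg = {z\<^sup>2 | z. \<sigma> z = z}"

lemma square_nonneg: "\<sigma> z = z \<Longrightarrow> z\<^sup>2 \<in> nonneg"
  by (auto simp: nonneg_def)

lemma nonneg_fixed: "x \<in> nonneg \<Longrightarrow> \<sigma> x = x"
  by (auto simp: nonneg_def power2_eq_square mult)

lemma nonneg_mult: "x \<in> nonneg \<Longrightarrow> y \<in> nonneg \<Longrightarrow> x * y \<in> nonneg"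
  unfolding nonneg_def using mult by (auto simp flip: power_mult_distrib)

text \<open>\<open>u^2 + v^2\<close> is the norm of \<open>u + i v\<close>. If \<open>w\<close> is a
  square root of \<open>u + i v\<close>, it is the square of the norm \<open>w * \<sigma> w\<close>,
  which is fixed.\<close>

lemma nonneg_add:
  assumes "x \<in> nonneg" "y \<in> nonneg"
  shows "x + y \<in> nonneg"
proof -
  obtain u v where uv: "x = u\<^sup>2" "\<sigma> u = u" "y = v\<^sup>2" "\<sigma> v = v"
    using assms by (auto simp: nonneg_def)
  obtain i where i: "i\<^sup>2 = (-1::'a)" using square_root_exists by blast
  obtain w where w: "w\<^sup>2 = u + i * v" using square_root_exists by blast
  have "(\<sigma> w)\<^sup>2 = u - i * v"
    using mult[of w w] w imaginary_unit[OF i] by (simp add: power2_eq_square[symmetric] add mult uv)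
  then have "(w * \<sigma> w)\<^sup>2 = (u + i * v) * (u - i * v)"
    using w by (simp add: power_mult_distrib)
  also have "\<dots> = u\<^sup>2 - i\<^sup>2 * v\<^sup>2"
    by (simp add: algebra_simps power2_eq_square)
  finally have "(w * \<sigma> w)\<^sup>2 = x + y" by (simp add: i uv)
  moreover have "\<sigma> (w * \<sigma> w) = w * \<sigma> w" by (simp add: mult invol)
  ultimately show ?thesis using square_nonneg by metis
qed

lemma of_nat_fixed: "\<sigma> (of_nat n) = of_nat n"
  by (induction n) (auto simp: zero one add)

lemma of_nat_nonneg: "of_nat n \<in> nonneg"
proof (induction n)
  case 0
  then show ?case using square_nonneg[OF zero] by simp
next
  case (Suc n)
  then show ?case using nonneg_add[OF square_nonneg[OF one]] by simp
qed

lemma inverse_of_nat_nonneg: "inverse (of_nat n) \<in> nonneg"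
proof (cases "n = 0")
  case False
  have "(inverse (of_nat n))\<^sup>2 * of_nat n \<in> nonneg"
    by (intro nonneg_mult square_nonneg of_nat_nonneg) (simp add: inverse of_nat_fixed)
  then show ?thesis using False by (simp add: power2_eq_square mult.assoc)
qed (use of_nat_nonneg[of 0] in simp)

lemma cubic_value_nonneg:
  assumes fixed: "\<sigma> a = a" "\<sigma> b = b" "\<sigma> c = c" and r: "r \<in> nonneg"
    and x: "x = 1 + a\<^sup>2 + b\<^sup>2 + c\<^sup>2 + r"
  shows "x ^ 3 + a * x\<^sup>2 + b * x + c \<in> nonneg"
proof -
  note [intro!] = nonneg_add nonneg_mult square_nonneg r
  have one': "1 \<in> nonneg" using square_nonneg[OF one] by simp
  have half: "inverse 2 \<in> nonneg" and three: "3 \<in> nonneg"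
    using inverse_of_nat_nonneg[of 2] of_nat_nonneg[of 3] by simp_all
  have d: "x - 1 \<in> nonneg" unfolding x by (auto simp: fixed)
  have "x = (x - 1) + 1" by simp
  also have "\<dots> \<in> nonneg" using d one' by blast
  finally have xn: "x \<in> nonneg" .
  note \<sigma>x = nonneg_fixed[OF xn]
  have \<sigma>h: "\<sigma> (1 / 2) = 1 / 2" using nonneg_fixed[OF half] by (simp add: inverse_eq_divide)
  have "x ^ 3 + a * x\<^sup>2 + b * x + c = x\<^sup>2 * x + a * x\<^sup>2 + b * x + c"
    by (simp add: power2_eq_square power3_eq_cube)
  \<comment> \<open>One factor \<open>x\<close> of the leading term is replaced by its definition,
    and the \<open>a^2\<close>, \<open>b^2\<close>, \<open>c^2\<close> so gained complete squares
    with the lower terms. The leftovers are \<open>1/4\<close>, \<open>r x^2\<close> and multiples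
    of \<open>x^2 - 1\<close>, which is nonnegative because \<open>x - 1\<close> is.\<close>
  also have "x\<^sup>2 * x = x\<^sup>2 * (1 + a\<^sup>2 + b\<^sup>2 + c\<^sup>2 + r)" by (simp flip: x)
  also have "x\<^sup>2 * (1 + a\<^sup>2 + b\<^sup>2 + c\<^sup>2 + r) + a * x\<^sup>2 + b * x + c
     = x\<^sup>2 * (a + inverse 2)\<^sup>2 + (b * x + inverse 2)\<^sup>2 + (c + inverse 2)\<^sup>2 + (x - 1) * (x + 1) * c\<^sup>2
       + 3 * (inverse 2)\<^sup>2 * ((x - 1) * (x + 1)) + (inverse 2)\<^sup>2 + r * x\<^sup>2"
    by (simp add: field_simps power2_eq_square)
  also have "\<dots> \<in> nonneg"
    using d xn one' three by (intro nonneg_add nonneg_mult square_nonneg r) (auto simp: add mult fixed \<sigma>x \<sigma>h)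
  finally show ?thesis .
qed

end

section \<open>Quadratic extensions and the maximal abelian extension\<close>

definition quadratic_extension :: "'a::field set \<Rightarrow> 'a \<Rightarrow> 'a set" where
  "quadratic_extension K y = {a + b * y | a b. a \<in> K \<and> b \<in> K}"

lemma quadratic_extension_superset:
  assumes "is_subfield K"
  shows "K \<subseteq> quadratic_extension K y" "y \<in> quadratic_extension K y"
proof -
  have "0 \<in> K" "1 \<in> K" using assms by (auto simp: is_subfield_iff)
  then show "K \<subseteq> quadratic_extension K y" "y \<in> quadratic_extension K y"
    unfolding quadratic_extension_def by force+
qed

lemma quadratic_extension_unique:
  fixes K :: "'a::field set"
  assumes K: "is_subfield K" and y: "y \<notin> K" and ab: "a \<in> K" "b \<in> K" "a' \<in> K" "b' \<in> K"
    and eq: "a + b * y = a' + b' * y"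
  shows "a = a'" "b = b'"
proof -
  show "b = b'"
  proof (rule ccontr)
    assume ne: "b \<noteq> b'"
    have "(b - b') * y = a' - a" using eq by (simp add: algebra_simps)
    then have "y = inverse (b - b') * (a' - a)"
      using ne by (simp add: field_simps)
    also have "\<dots> = inverse (b + - b') * (a' + - a)" by simp
    also have "\<dots> \<in> K" using K ab unfolding is_subfield_iff by blast
    finally show False using y by simp
  qed
  then show "a = a'" using eq by simp
qed

lemma quadratic_extension_subfield:
  fixes K :: "'a::field set"
  assumes K: "is_subfield K" and y: "y\<^sup>2 \<in> K"
  shows "is_subfield (quadratic_extension K y)"
proof (cases "y \<in> K")
  case True
  then have "quadratic_extension K y = K"
    using K quadratic_extension_superset[OF K, of y] unfolding is_subfield_iff quadratic_extension_def by blast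
  then show ?thesis using K by simp
next
  case False
  note cl = K[unfolded is_subfield_iff]
  have inv: "inverse (a + b * y) \<in> quadratic_extension K y" if ab: "a \<in> K" "b \<in> K" for a b
  proof (cases "a + b * y = 0")
    case True
    then show ?thesis using quadratic_extension_superset[OF K, of y] cl by auto
  next
    case ne: False
    have n: "(a + b * y) * (a - b * y) = a * a + - (b * b * y\<^sup>2)"
      by (simp add: algebra_simps power2_eq_square)
    have "a - b * y \<noteq> 0"
    proof
      assume "a - b * y = 0"
      then have "a = 0 \<and> b = 0"
        using quadratic_extension_unique[OF K False, of a "- b" 0 0] ab cl by auto
      then show False using ne by simp
    qed
    moreover have "inverse u = v * inverse (u * v)" if "v \<noteq> 0" for u v :: 'a
      using that by (simp add: field_simps)
    ultimately have "inverse (a + b * y) = (a - b * y) * inverse (a * a + - (b * b * y\<^sup>2))"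
      unfolding n[symmetric] by blast
    also have "\<dots> = a * inverse (a * a + - (b * b * y\<^sup>2)) + (- b * inverse (a * a + - (b * b * y\<^sup>2))) * y"
      by (simp add: algebra_simps)
    also have "\<dots> \<in> quadratic_extension K y"
      unfolding quadratic_extension_def using cl ab y by blast
    finally show ?thesis .
  qed
  have ring: "(a + b * y) + (a' + b' * y) = (a + a') + (b + b') * y"
    "(a + b * y) * (a' + b' * y) = (a * a' + b * b' * y\<^sup>2) + (a * b' + b * a') * y"
    "- (a + b * y) = - a + (- b) * y" for a b a' b'
    by (simp_all add: algebra_simps power2_eq_square)
  have in_ext: "x \<in> quadratic_extension K y \<longleftrightarrow> (\<exists>a\<in>K. \<exists>b\<in>K. x = a + b * y)" for x
    unfolding quadratic_extension_def by blast
  have closed: "inverse x \<in> quadratic_extension K y" "- x \<in> quadratic_extension K y"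
      "x' \<in> quadratic_extension K y \<Longrightarrow> x + x' \<in> quadratic_extension K y \<and> x * x' \<in> quadratic_extension K y"
    if xM: "x \<in> quadratic_extension K y" for x x'
  proof -
    obtain a b where x: "a \<in> K" "b \<in> K" "x = a + b * y" using xM in_ext by blast
    then show "inverse x \<in> quadratic_extension K y" by (simp add: inv)
    show "- x \<in> quadratic_extension K y"
      unfolding x(3) ring(3) in_ext using cl x by blast
    assume "x' \<in> quadratic_extension K y"
    then obtain a' b' where x': "a' \<in> K" "b' \<in> K" "x' = a' + b' * y" using in_ext by blast
    have "a + a' \<in> K" "b + b' \<in> K" "a * a' + b * b' * y\<^sup>2 \<in> K" "a * b' + b * a' \<in> K"
      using cl x x' y by blast+
    then show "x + x' \<in> quadratic_extension K y \<and> x * x' \<in> quadratic_extension K y"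
      unfolding x(3) x'(3) ring(1,2) in_ext by blast
  qed
  show ?thesis
    unfolding is_subfield_iff using closed cl quadratic_extension_superset[OF K, of y] by blast
qed

lemma quadratic_extension_abelian:
  fixes K :: "'a::field_char_0 set"
  assumes K: "is_subfield K" and y2: "y\<^sup>2 \<in> K" and y: "y \<notin> K"
  shows "abelian_extension K (quadratic_extension K y)"
proof -
  define M where "M = quadratic_extension K y"
  note cl = K[unfolded is_subfield_iff]
  have M: "is_subfield M"
    unfolding M_def by (rule quadratic_extension_subfield[OF K y2])
  have KM: "K \<subseteq> M" and yM: "y \<in> M"
    unfolding M_def using quadratic_extension_superset[OF K] by blast+
  have in_M: "x \<in> M \<longleftrightarrow> (\<exists>a\<in>K. \<exists>b\<in>K. x = a + b * y)" for x
    unfolding M_def quadratic_extension_def by blast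
  then obtain re im where reim: "\<And>x. x \<in> M \<Longrightarrow> re x \<in> K \<and> im x \<in> K \<and> x = re x + im x * y"
    by metis
  \<comment> \<open>The conjugation sending \<open>y\<close> to \<open>- y\<close>, restricted to
    \<open>M\<close> because elements of \<open>Bij M\<close> are \<open>undefined\<close>
    elsewhere. It alone cuts the fixed field down to \<open>K\<close>.\<close>
  define \<tau> where "\<tau> = (\<lambda>x\<in>M. re x - im x * y)"
  have memM: "a + b * y \<in> M" if "a \<in> K" "b \<in> K" for a b
    using that in_M by blast
  have \<tau>: "\<tau> (a + b * y) = a - b * y" if ab: "a \<in> K" "b \<in> K" for a b
  proof -
    have "a + b * y \<in> M" using ab by (rule memM)
    with reim[OF this] show ?thesis
      using quadratic_extension_unique[OF K y ab, of "re (a + b * y)" "im (a + b * y)"]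
      by (simp add: \<tau>_def)
  qed
  have \<tau>M: "\<tau> x \<in> M" "\<tau> (\<tau> x) = x" if x: "x \<in> M" for x
  proof -
    obtain a b where ab: "a \<in> K" "b \<in> K" "x = a + b * y" using x in_M by blast
    have e: "a - b * y = a + (- b) * y" by simp
    have b': "- b \<in> K" using cl ab by blast
    show "\<tau> x \<in> M"
      unfolding ab(3) \<tau>[OF ab(1,2)] e by (rule memM[OF ab(1) b'])
    show "\<tau> (\<tau> x) = x"
      unfolding ab(3) \<tau>[OF ab(1,2)] e \<tau>[OF ab(1) b'] by simp
  qed
  have "bij_betw \<tau> M M"
    by (rule bij_betw_byWitness[of M \<tau> \<tau>]) (use \<tau>M in auto)
  then have "\<tau> \<in> Bij M"
    by (simp add: Bij_def \<tau>_def)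
  moreover have "\<tau> (x + x') = \<tau> x + \<tau> x' \<and> \<tau> (x * x') = \<tau> x * \<tau> x'" if x: "x \<in> M" and x': "x' \<in> M" for x x'
  proof -
    obtain a b a' b' where ab: "a \<in> K" "b \<in> K" "x = a + b * y" "a' \<in> K" "b' \<in> K" "x' = a' + b' * y"
      using x x' in_M by blast
    have m: "a + a' \<in> K" "b + b' \<in> K" "a * a' + b * b' * y\<^sup>2 \<in> K" "a * b' + b * a' \<in> K"
      using cl ab y2 by blast+
    have e: "(a + b * y) + (a' + b' * y) = (a + a') + (b + b') * y"
      "(a + b * y) * (a' + b' * y) = (a * a' + b * b' * y\<^sup>2) + (a * b' + b * a') * y"
      by (simp_all add: algebra_simps power2_eq_square)
    show ?thesis
      unfolding ab(3,6) e \<tau>[OF m(1,2)] \<tau>[OF m(3,4)] \<tau>[OF ab(1,2)] \<tau>[OF ab(4,5)]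
      by (simp add: algebra_simps power2_eq_square)
  qed
  moreover have \<tau>K: "\<tau> x = x" if "x \<in> K" for x
    using \<tau>[OF that, of 0] cl by simp
  ultimately have \<tau>G: "\<tau> \<in> carrier (Gal M K)"
    by (simp add: Gal_def)
  have "algebraic_over K x" if x: "x \<in> M" for x
  proof -
    obtain a b where ab: "a \<in> K" "b \<in> K" "x = a + b * y" using x in_M by blast
    define c0 c1 where c: "c0 = a * a + - (b * b * y\<^sup>2)" "c1 = - (a + a)"
    have "c0 \<in> K" "c1 \<in> K"
      unfolding c using cl ab y2 by blast+
    define p where "p = [:c0, c1, 1:]"
    have "poly p x = 0"
      unfolding p_def ab(3) c by (simp add: algebra_simps power2_eq_square)
    moreover have "coeff p i \<in> K" for i
      using \<open>c0 \<in> K\<close> \<open>c1 \<in> K\<close> cl by (simp add: p_def coeff_pCons split: nat.split)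
    moreover have "p \<noteq> 0" by (simp add: p_def)
    ultimately show ?thesis unfolding algebraic_over_def by blast
  qed
  moreover have "{x \<in> M. \<forall>f \<in> carrier (Gal M K). f x = x} = K"
  proof (intro equalityI subsetI)
    fix x assume x: "x \<in> {x \<in> M. \<forall>f \<in> carrier (Gal M K). f x = x}"
    then obtain a b where ab: "a \<in> K" "b \<in> K" "x = a + b * y" using in_M by blast
    have "\<tau> x = x" using x \<tau>G by blast
    then have "a + (- b) * y = a + b * y" using \<tau>[OF ab(1,2)] ab(3) by simp
    moreover have "- b \<in> K" using cl ab by blast
    ultimately have "- b = b" using quadratic_extension_unique(2)[OF K y ab(1) _ ab(1,2)] by blast
    then have "b = 0" using neg_eq_iff_add_eq_0[of b b] by simp
    then show "x \<in> K" using ab by simp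
  qed (use KM in \<open>auto simp: Gal_def\<close>)
  ultimately have "galois_extension K M"
    using K M KM by (simp add: galois_extension_def)
  moreover have "comm_group (Gal M K)"
  proof (rule group.group_comm_groupI[OF group_Gal[OF M KM]])
    fix f g assume fg: "f \<in> carrier (Gal M K)" "g \<in> carrier (Gal M K)"
    have hom: "h (x + x') = h x + h x'" "h (x * x') = h x * h x'"
      if "h \<in> carrier (Gal M K)" "x \<in> M" "x' \<in> M" for h x x'
      using that by (auto simp: Gal_def)
    have fixK: "h x = x" if "h \<in> carrier (Gal M K)" "x \<in> K" for h x
      using that by (auto simp: Gal_def)
    have h_eq: "h (a + b * y) = a + b * h y" if "h \<in> carrier (Gal M K)" "a \<in> K" "b \<in> K" for h a b
    proof -
      have "b * y \<in> M" using memM[of 0 b] cl that by simp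
      then show ?thesis
        using hom[OF that(1)] fixK[OF that(1)] that KM yM by (simp add: subset_iff)
    qed
    \<comment> \<open>An automorphism is determined by the image of \<open>y\<close>, which is one
      of the two square roots of \<open>y^2\<close>; such sign changes commute.\<close>
    have hy: "h y = y \<or> h y = - y" if "h \<in> carrier (Gal M K)" for h
      using hom(2)[OF that yM yM] fixK[OF that y2] power2_eq_iff[of "h y" y] by (simp add: power2_eq_square)
    have "f (g x) = g (f x)" if x: "x \<in> M" for x
    proof -
      obtain a b where ab: "a \<in> K" "b \<in> K" "x = a + b * y" using x in_M by blast
      have b': "- b \<in> K" using cl ab by blast
      show ?thesis
        using hy[OF fg(1)] hy[OF fg(2)] h_eq[OF fg(1) ab(1,2)] h_eq[OF fg(2) ab(1,2)]
          h_eq[OF fg(1) ab(1) b'] h_eq[OF fg(2) ab(1) b'] unfolding ab(3) by auto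
    qed
    moreover have "f \<in> Bij M" "g \<in> Bij M" using fg by (auto simp: Gal_def)
    ultimately show "f \<otimes>\<^bsub>Gal M K\<^esub> g = g \<otimes>\<^bsub>Gal M K\<^esub> f"
      by (auto simp: Gal_def BijGroup_def compose_def restrict_def fun_eq_iff)
  qed
  ultimately show ?thesis
    unfolding abelian_extension_def M_def by simp
qed

lemma is_subfield_max_abelian_extension: "is_subfield (max_abelian_extension K)"
  unfolding is_subfield_iff max_abelian_extension_def by blast

lemma quadratic_extension_subset_max_abelian:
  fixes K :: "'a::field_char_0 set"
  assumes "is_subfield K" "y\<^sup>2 \<in> K" "y \<notin> K"
  shows "quadratic_extension K y \<subseteq> max_abelian_extension K"
  using quadratic_extension_abelian[OF assms] unfolding max_abelian_extension_def by blast

lemma (in involution) is_subfield_fixed_field: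
  assumes "is_subfield M"
  shows "is_subfield (fixed_field M \<sigma>)"
  using assms unfolding is_subfield_iff fixed_field_def
  by (auto simp: zero one add mult uminus inverse)

section \<open>Unramified primes of a number field\<close>

definition local_ints :: "nat \<Rightarrow> rat set" where
  "local_ints p = {r. \<exists>n::nat. \<not> p dvd n \<and> of_nat n * r \<in> \<int>}"

lemma local_intsI: "\<not> p dvd n \<Longrightarrow> of_nat n * r \<in> \<int> \<Longrightarrow> r \<in> local_ints p"
  by (auto simp: local_ints_def)

lemma Ints_local_ints: "prime p \<Longrightarrow> r \<in> \<int> \<Longrightarrow> r \<in> local_ints p"
  by (rule local_intsI[of p 1]) auto

lemma local_ints_closed:
  assumes p: "prime p" and rs: "r \<in> local_ints p" "s \<in> local_ints p"
  shows "r + s \<in> local_ints p" "r * s \<in> local_ints p" "- r \<in> local_ints p" "r - s \<in> local_ints p"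
proof -
  from rs obtain n m where n: "\<not> p dvd n" "of_nat n * r \<in> \<int>" and m: "\<not> p dvd m" "of_nat m * s \<in> \<int>"
    by (auto simp: local_ints_def)
  have nm: "\<not> p dvd n * m"
    using n m p by (simp add: prime_dvd_mult_iff)
  have e: "of_nat (n * m) * (r + s) = of_nat m * (of_nat n * r) + of_nat n * (of_nat m * s)"
    "of_nat (n * m) * (r - s) = of_nat m * (of_nat n * r) - of_nat n * (of_nat m * s)"
    "of_nat (n * m) * (r * s) = (of_nat n * r) * (of_nat m * s)"
    by (simp_all add: algebra_simps)
  show "r + s \<in> local_ints p" "r * s \<in> local_ints p" "r - s \<in> local_ints p"
    by (rule local_intsI[OF nm], unfold e, use n m in auto)+
  show "- r \<in> local_ints p"
    by (rule local_intsI[OF n(1)]) (use n in auto)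
qed

lemma sum_local_ints:
  assumes "prime p" "\<And>i. i \<in> I \<Longrightarrow> r i \<in> local_ints p"
  shows "sum r I \<in> local_ints p"
  using assms(2) by (induction I rule: infinite_finite_induct)
    (auto intro: local_ints_closed Ints_local_ints assms(1))

lemma inverse_prime_not_local_ints:
  assumes "prime p" shows "inverse (of_nat p) \<notin> local_ints p"
proof
  assume "inverse (of_nat p) \<in> local_ints p"
  then obtain n k where n: "\<not> p dvd n" "of_nat n * inverse (of_nat p) = (of_int k :: rat)"
    by (auto simp: local_ints_def elim: Ints_cases)
  moreover have "p \<noteq> 0" using assms by auto
  ultimately have "(of_nat n :: rat) = of_int (k * int p)"
    by (simp add: field_simps)
  then have "int n = k * int p"
    by (metis of_int_eq_iff of_int_of_nat_eq)
  then have "int p dvd int n" by simp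
  then show False using n by simp
qed

text \<open>The ring of \<open>p\<close>-integral rationals is local with maximal ideal generated by
  \<open>p\<close>. The alternative supplies the invertible pivots of the elimination below.\<close>

lemma local_ints_cases:
  assumes p: "prime p" and r: "r \<in> local_ints p"
  obtains "r / of_nat p \<in> local_ints p" | "r \<noteq> 0" "inverse r \<in> local_ints p"
proof -
  obtain n k where n: "\<not> p dvd n" "of_nat n * r = of_int k"
    using r by (auto simp: local_ints_def elim: Ints_cases)
  have p0: "p \<noteq> 0" using p by auto
  show ?thesis
  proof (cases "int p dvd k")
    case True
    then obtain j where j: "k = int p * j" by auto
    have "of_nat n * (r / of_nat p) = (of_int j :: rat)"
      using n(2) p0 unfolding j by (simp add: field_simps)
    then show ?thesis using that(1) local_intsI[OF n(1)] by (metis Ints_of_int)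
  next
    case False
    then have k: "k \<noteq> 0" by auto
    then have r0: "r \<noteq> 0" using n by auto
    have r': "inverse r = of_nat n / of_int k"
      using n(2) r0 k by (simp add: field_simps)
    have "\<not> p dvd nat \<bar>k\<bar>"
      using False by (metis dvd_abs_iff int_dvd_int_iff nat_0_le abs_ge_zero)
    moreover have "of_nat (nat \<bar>k\<bar>) * inverse r = (of_int (sgn k * int n) :: rat)"
      using k unfolding r' by (cases "k > 0") (simp_all add: of_nat_nat)
    ultimately have "inverse r \<in> local_ints p"
      using local_intsI by (metis Ints_of_int)
    then show ?thesis using that(2) r0 by blast
  qed
qed

interpretation rat_vs: vector_space "\<lambda>(q::rat) (x::'a::field_char_0). of_rat q * x"
  by (rule vector_space_of_rat)

declare rat_vs.scale_scale [simp del]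

text \<open>Gaussian elimination modulo \<open>p\<close>: matrices over a field are von Neumann regular.\<close>

lemma functionals_regular:
  fixes L :: "'a::field_char_0 set" and \<phi> :: "'i \<Rightarrow> 'a \<Rightarrow> rat"
  assumes p: "prime p" and I: "finite I"
    and L: "\<And>x y. x \<in> L \<Longrightarrow> y \<in> L \<Longrightarrow> x + y \<in> L" "\<And>r x. r \<in> local_ints p \<Longrightarrow> x \<in> L \<Longrightarrow> of_rat r * x \<in> L"
      "0 \<in> L"
    and val: "\<And>i x. i \<in> I \<Longrightarrow> x \<in> L \<Longrightarrow> \<phi> i x \<in> local_ints p"
    and add: "\<And>i x y. \<phi> i (x + y) = \<phi> i x + \<phi> i y"
    and scale: "\<And>i r x. \<phi> i (of_rat r * x) = r * \<phi> i x"
  shows "\<exists>s. (\<forall>i\<in>I. s i \<in> L) \<and> (\<forall>i\<in>I. \<forall>y\<in>L.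
    (\<phi> i (\<Sum>l\<in>I. of_rat (\<phi> l y) * s l) - \<phi> i y) / of_nat p \<in> local_ints p)"
  using I val
proof (induction I rule: finite_induct)
  case (insert i0 I)
  note cl = local_ints_closed[OF p]
  have z: "\<phi> i 0 = 0" for i using scale[of i 0 0] by simp
  have phi_sum: "\<phi> i (sum g J) = (\<Sum>j\<in>J. \<phi> i (g j))" for i g and J :: "'i set"
    by (induction J rule: infinite_finite_induct) (auto simp: add z)
  have Lsum: "sum g J \<in> L" if "\<And>j. j \<in> J \<Longrightarrow> g j \<in> L" for g and J :: "'i set"
    using that by (induction J rule: infinite_finite_induct) (auto simp: L)
  have uminus: "- x \<in> L" if "x \<in> L" for x
    using L(2)[of "-1" x] that Ints_local_ints[OF p, of "-1"] by simp
  have phi_uminus: "\<phi> i (- x) = - \<phi> i x" for i x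
    using scale[of i "-1" x] by simp
  obtain s where s: "\<And>i. i \<in> I \<Longrightarrow> s i \<in> L"
    and reg: "\<And>i y. i \<in> I \<Longrightarrow> y \<in> L \<Longrightarrow>
      (\<phi> i (\<Sum>l\<in>I. of_rat (\<phi> l y) * s l) - \<phi> i y) / of_nat p \<in> local_ints p"
    using insert.IH insert.prems by (metis insertI2)
  define S where "S y = (\<Sum>l\<in>I. of_rat (\<phi> l y) * s l)" for y
  have SL: "S y \<in> L" if "y \<in> L" for y
    unfolding S_def by (rule Lsum, rule L(2)) (use that s insert.prems in auto)
  have val0: "\<phi> i0 x \<in> local_ints p" if "x \<in> L" for x using insert.prems that by simp
  show ?case
  proof (cases "\<forall>y\<in>L. (\<phi> i0 (S y) - \<phi> i0 y) / of_nat p \<in> local_ints p")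
    case True
    \<comment> \<open>The old section already reproduces the new functional modulo \<open>p\<close>,
      so the new section vector can be 0.\<close>
    define s' where "s' = s(i0 := 0)"
    have "(\<Sum>l\<in>insert i0 I. of_rat (\<phi> l y) * s' l) = S y" for y
      unfolding S_def s'_def using insert.hyps by (auto simp: sum.insert intro!: sum.cong)
    then show ?thesis
      using True reg s L(3) by (intro exI[of _ s']) (auto simp: S_def s'_def)
  next
    case False
    then obtain e where e: "e \<in> L" "(\<phi> i0 (S e) - \<phi> i0 e) / of_nat p \<notin> local_ints p"
      by blast
    \<comment> \<open>\<open>w\<close> is the error of the old section at a vector \<open>e\<close>
      where it fails. The old functionals vanish on \<open>w\<close> modulo \<open>p\<close> and the
      new one is a unit there, which makes \<open>w\<close> the pivot vector.\<close>
    define w where "w = e + - S e"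
    have wL: "w \<in> L" using e SL L uminus by (simp add: w_def del: add_uminus_conv_diff)
    define m where "m = \<phi> i0 w"
    have m: "m = - (\<phi> i0 (S e) - \<phi> i0 e)"
      unfolding m_def w_def add phi_uminus by simp
    have "- (m / of_nat p) \<notin> local_ints p" using e(2) unfolding m by (simp add: minus_divide_left)
    then have "m / of_nat p \<notin> local_ints p" using cl(3)[of "m / of_nat p"] by blast
    moreover have "m \<in> local_ints p" using val0[OF wL] by (simp add: m_def)
    ultimately have m0: "m \<noteq> 0" and im: "inverse m \<in> local_ints p"
      using local_ints_cases[OF p] by blast+
    \<comment> \<open>The correction makes \<open>\<phi> i0\<close> vanish on the old section
      vectors, so that the new vector alone restores the value of \<open>\<phi> i0\<close>. The old
      functionals change only by multiples of \<open>p\<close>.\<close>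
    define s' where "s' = (\<lambda>l. s l + - (of_rat (\<phi> i0 (s l) * inverse m) * w))(i0 := of_rat (inverse m) * w)"
    have s'L: "s' i \<in> L" if "i \<in> insert i0 I" for i
    proof (cases "i = i0")
      case True
      then show ?thesis using L(2)[OF im wL] by (simp add: s'_def)
    next
      case False
      then have "s i \<in> L" using s that by simp
      then have "s i + - (of_rat (\<phi> i0 (s i) * inverse m) * w) \<in> L"
        using L(2)[OF cl(2)[OF val0 im] wL] L(1) uminus by blast
      then show ?thesis using False by (simp add: s'_def)
    qed
    have S': "(\<Sum>l\<in>insert i0 I. of_rat (\<phi> l y) * s' l)
        = S y + of_rat ((\<phi> i0 y - \<phi> i0 (S y)) * inverse m) * w" for y
    proof -
      have s'_eq: "s' l = s l - of_rat (\<phi> i0 (s l)) * (of_rat (inverse m) * w)" if "l \<in> I" for l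
        using that insert.hyps(2) unfolding s'_def by (auto simp: of_rat_mult mult.assoc)
      have "(\<Sum>l\<in>I. of_rat (\<phi> l y) * s' l)
          = (\<Sum>l\<in>I. of_rat (\<phi> l y) * s l - of_rat (\<phi> l y * \<phi> i0 (s l)) * (of_rat (inverse m) * w))"
        by (rule sum.cong) (simp_all add: s'_eq right_diff_distrib of_rat_mult mult.assoc)
      also have "\<dots> = S y - of_rat (\<phi> i0 (S y)) * (of_rat (inverse m) * w)"
        unfolding sum_subtractf S_def phi_sum scale of_rat_sum sum_distrib_right ..
      finally have "(\<Sum>l\<in>I. of_rat (\<phi> l y) * s' l) = S y - of_rat (\<phi> i0 (S y)) * (of_rat (inverse m) * w)" .
      moreover have "s' i0 = of_rat (inverse m) * w" by (simp add: s'_def)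
      ultimately show ?thesis
        unfolding sum.insert[OF insert.hyps] of_rat_mult of_rat_diff
        by (simp only: mult.assoc left_diff_distrib) (simp only: diff_conv_add_uminus ac_simps)
    qed
    have "(\<phi> i (\<Sum>l\<in>insert i0 I. of_rat (\<phi> l y) * s' l) - \<phi> i y) / of_nat p \<in> local_ints p"
      if i: "i \<in> insert i0 I" and y: "y \<in> L" for i y
    proof (cases "i = i0")
      case True
      have "\<phi> i (\<Sum>l\<in>insert i0 I. of_rat (\<phi> l y) * s' l) - \<phi> i y = 0"
        unfolding S' add scale True m_def[symmetric] using m0 by (simp add: mult.assoc)
      then show ?thesis using Ints_local_ints[OF p] by simp
    next
      case False
      then have iI: "i \<in> I" using i by simp
      have "\<phi> i w / of_nat p = - ((\<phi> i (S e) - \<phi> i e) / of_nat p)"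
        unfolding w_def add phi_uminus by (simp add: diff_divide_distrib)
      then have "\<phi> i w / of_nat p \<in> local_ints p"
        using reg[OF iI e(1)] cl(3) unfolding S_def by metis
      then have "(\<phi> i (S y) - \<phi> i y) / of_nat p
          + (\<phi> i0 y - \<phi> i0 (S y)) * inverse m * (\<phi> i w / of_nat p) \<in> local_ints p"
        using cl(1)[OF reg[OF iI y, folded S_def] cl(2)[OF cl(2)[OF cl(4)[OF val0[OF y] val0[OF SL[OF y]]] im]]]
        by blast
      also have "(\<phi> i (S y) - \<phi> i y) / of_nat p
          + (\<phi> i0 y - \<phi> i0 (S y)) * inverse m * (\<phi> i w / of_nat p)
        = (\<phi> i (\<Sum>l\<in>insert i0 I. of_rat (\<phi> l y) * s' l) - \<phi> i y) / of_nat p"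
        unfolding S' add scale by (simp add: add_divide_distrib diff_divide_distrib)
      finally show ?thesis .
    qed
    then show ?thesis using s'L by blast
  qed
qed simp

section \<open>Orders of a number field at each prime\<close>

locale number_field_basis =
  fixes K :: "'a::field_char_0 set" and B :: "'a set"
  assumes subfield: "is_subfield K" and finite_B: "finite B"
    and indep_B: "rat_vs.independent B" and span_B: "rat_vs.span B = K"
begin

text \<open>Coordinates with respect to a basis of the whole ambient field, so that they are linear
  everywhere.\<close>

definition coord :: "'a \<Rightarrow> 'a \<Rightarrow> rat" where
  "coord b z = rat_vs.representation (rat_vs.extend_basis B) z b"

lemma K_closed [intro]:
  "0 \<in> K" "1 \<in> K" "x \<in> K \<Longrightarrow> y \<in> K \<Longrightarrow> x + y \<in> K" "x \<in> K \<Longrightarrow> y \<in> K \<Longrightarrow> x * y \<in> K"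
  "x \<in> K \<Longrightarrow> - x \<in> K" "x \<in> K \<Longrightarrow> inverse x \<in> K"
  using subfield by (auto simp: is_subfield_iff)

lemma B_subset_K: "b \<in> B \<Longrightarrow> b \<in> K"
  using rat_vs.span_base span_B by blast

lemma of_rat_in_K: "z \<in> K \<Longrightarrow> of_rat r * z \<in> K"
  using rat_vs.span_scale[of z B r] span_B by simp

lemma coord_add: "coord b (x + y) = coord b x + coord b y"
  unfolding coord_def
  by (simp add: rat_vs.representation_add rat_vs.independent_extend_basis rat_vs.span_extend_basis indep_B)

lemma coord_scale: "coord b (of_rat r * x) = r * coord b x"
  unfolding coord_def
  by (simp add: rat_vs.representation_scale rat_vs.independent_extend_basis rat_vs.span_extend_basis indep_B)

lemma coord_0 [simp]: "coord b 0 = 0"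
  using coord_scale[of b 0 0] by simp

lemma coord_diff: "coord b (x - y) = coord b x - coord b y"
  using coord_add[of b "x - y" y] by simp

lemma coord_sum: "coord b (sum g J) = (\<Sum>j\<in>J. coord b (g j))"
  by (induction J rule: infinite_finite_induct) (auto simp: coord_add)

lemma coord_basis: "b \<in> B \<Longrightarrow> coord b' b = (if b' = b then 1 else 0)"
  unfolding coord_def using rat_vs.extend_basis_superset[OF indep_B]
  by (subst rat_vs.representation_basis) (auto simp: rat_vs.independent_extend_basis indep_B)

lemma coord_expand:
  assumes "z \<in> K"
  shows "z = (\<Sum>b\<in>B. of_rat (coord b z) * b)"
proof -
  have "rat_vs.representation (rat_vs.extend_basis B) z = rat_vs.representation B z"
    using rat_vs.representation_extend[OF rat_vs.independent_extend_basis[OF indep_B]]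
      rat_vs.extend_basis_superset[OF indep_B] assms span_B by blast
  then show ?thesis
    using rat_vs.sum_representation_eq[OF indep_B _ finite_B order_refl, of z] assms span_B
    by (simp add: coord_def)
qed

lemma coord_eqI:
  assumes "z \<in> K" "w \<in> K" "\<And>b. b \<in> B \<Longrightarrow> coord b z = coord b w"
  shows "z = w"
  using coord_expand[OF assms(1)] coord_expand[OF assms(2)] assms(3) by simp

lemma coord_mult_expand:
  assumes "w \<in> K"
  shows "coord c (z * w) = (\<Sum>b\<in>B. coord b w * coord c (z * b))"
  by (subst coord_expand[OF assms])
    (simp add: sum_distrib_left coord_sum coord_scale mult.left_commute[of z])

lemma B_nonempty: "B \<noteq> {}"
proof
  assume "B = {}"
  then have "(1::'a) = 0" using coord_expand[of 1] K_closed by simp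
  then show False by simp
qed

text \<open>The stabiliser of the \<open>p\<close>-integral lattice spanned by \<open>B\<close>:
  multiplication by \<open>z\<close> has a \<open>p\<close>-integral matrix. It is a ring for every
  basis, whereas the lattice itself need neither be closed under products nor contain 1.\<close>

definition multiplier_ring :: "nat \<Rightarrow> 'a set" where
  "multiplier_ring p = {z \<in> K. \<forall>b\<in>B. \<forall>c\<in>B. coord c (z * b) \<in> local_ints p}"

lemma multiplier_ring_closed:
  assumes p: "prime p"
  shows "1 \<in> multiplier_ring p"
    "x \<in> multiplier_ring p \<Longrightarrow> y \<in> multiplier_ring p \<Longrightarrow> x + y \<in> multiplier_ring p"
    "x \<in> multiplier_ring p \<Longrightarrow> y \<in> multiplier_ring p \<Longrightarrow> x * y \<in> multiplier_ring p"
    "r \<in> local_ints p \<Longrightarrow> x \<in> multiplier_ring p \<Longrightarrow> of_rat r * x \<in> multiplier_ring p"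
proof -
  note cl = local_ints_closed[OF p]
  show "1 \<in> multiplier_ring p"
    using Ints_local_ints[OF p] K_closed by (auto simp: multiplier_ring_def coord_basis)
  show "x \<in> multiplier_ring p \<Longrightarrow> y \<in> multiplier_ring p \<Longrightarrow> x + y \<in> multiplier_ring p"
    using cl(1) K_closed by (auto simp: multiplier_ring_def distrib_right coord_add)
  show "r \<in> local_ints p \<Longrightarrow> x \<in> multiplier_ring p \<Longrightarrow> of_rat r * x \<in> multiplier_ring p"
    using cl(2) of_rat_in_K by (auto simp: multiplier_ring_def mult.assoc coord_scale)
  assume x: "x \<in> multiplier_ring p" and y: "y \<in> multiplier_ring p"
  have "coord c (x * y * b) \<in> local_ints p" if "b \<in> B" "c \<in> B" for b c
  proof -
    have "y * b \<in> K" using y B_subset_K[OF that(1)] K_closed by (auto simp: multiplier_ring_def)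
    then have "coord c (x * y * b) = (\<Sum>d\<in>B. coord d (y * b) * coord c (x * d))"
      using coord_mult_expand[of "y * b" c x] by (simp add: mult.assoc)
    then show ?thesis
      using x y that by (auto simp: multiplier_ring_def intro!: sum_local_ints[OF p] cl)
  qed
  then show "x * y \<in> multiplier_ring p"
    using x y K_closed by (auto simp: multiplier_ring_def)
qed

lemma sum_multiplier_ring:
  assumes "prime p" "\<And>i. i \<in> I \<Longrightarrow> g i \<in> multiplier_ring p"
  shows "sum g I \<in> multiplier_ring p"
proof -
  have "0 \<in> multiplier_ring p"
    using multiplier_ring_closed(4)[OF assms(1) _ multiplier_ring_closed(1)[OF assms(1)], of 0]
      Ints_local_ints[OF assms(1), of 0] by simp
  then show ?thesis
    using assms(2) by (induction I rule: infinite_finite_induct)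
      (auto intro: multiplier_ring_closed assms(1))
qed

lemma inverse_prime_not_multiplier_ring:
  assumes "prime p" shows "inverse (of_nat p) \<notin> multiplier_ring p"
proof
  assume *: "inverse (of_nat p) \<in> multiplier_ring p"
  obtain b where b: "b \<in> B" using B_nonempty by blast
  have "coord b (of_rat (inverse (of_nat p)) * b) \<in> local_ints p"
    using * b by (auto simp: multiplier_ring_def of_rat_inverse)
  then show False
    using inverse_prime_not_local_ints[OF assms] b by (simp add: coord_scale coord_basis)
qed

lemma common_denominator:
  assumes "finite (S :: rat set)"
  shows "\<exists>N>0. \<forall>r\<in>S. of_nat N * r \<in> \<int>"
  using assms
proof (induction S rule: finite_induct)
  case (insert r S)
  then obtain N where N: "N > 0" "\<forall>r\<in>S. of_nat N * r \<in> \<int>" by blast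
  obtain a b where ab: "r = of_int a / of_int b" "b > 0"
    by (metis quotient_of_div quotient_of_denom_pos surj_pair)
  then have rb: "of_nat (nat b) * r \<in> \<int>"
    by simp
  have "of_nat (N * nat b) * s \<in> \<int>" if "s \<in> insert r S" for s
  proof (cases "s = r")
    case True
    have "of_nat (N * nat b) * s = of_nat N * (of_nat (nat b) * r)" using True by simp
    then show ?thesis using rb by (metis Ints_mult Ints_of_nat)
  next
    case False
    have "of_nat (N * nat b) * s = of_nat (nat b) * (of_nat N * s)" by simp
    moreover have "of_nat N * s \<in> \<int>" using N that False by blast
    ultimately show ?thesis by (metis Ints_mult Ints_of_nat)
  qed
  moreover have "N * nat b > 0" using N ab by simp
  ultimately show ?case by blast
qed auto

text \<open>One \<open>N\<close> serves all primes at once, since it clears the finitely many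
  entries of the multiplication matrix of \<open>z\<close>.\<close>

lemma denominator_multiplier_ring:
  assumes "z \<in> K"
  shows "\<exists>N>0. \<forall>p. prime p \<longrightarrow> of_nat N * z \<in> multiplier_ring p \<and>
    (\<not> p dvd N \<longrightarrow> z \<in> multiplier_ring p)"
proof -
  have "finite ((\<lambda>(b, c). coord c (z * b)) ` (B \<times> B))" using finite_B by simp
  from common_denominator[OF this] obtain N where N: "N > 0"
      "\<And>b c. b \<in> B \<Longrightarrow> c \<in> B \<Longrightarrow> of_nat N * coord c (z * b) \<in> \<int>"
    by auto
  have sc: "coord c (of_nat N * z * b) = of_nat N * coord c (z * b)" for b c
    using coord_scale[of c "of_nat N" "z * b"] by (simp add: mult.assoc)
  have NK: "of_nat N * z \<in> K" using of_rat_in_K[OF assms, of "of_nat N"] by simp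
  show ?thesis
    using N assms NK
    by (intro exI[of _ N]) (auto simp: multiplier_ring_def sc intro: Ints_local_ints local_intsI)
qed

lemma denominator_multiplier_ring_finite:
  assumes "finite S" "S \<subseteq> K"
  shows "\<exists>N>0. \<forall>p. prime p \<longrightarrow> \<not> p dvd N \<longrightarrow> S \<subseteq> multiplier_ring p"
  using assms
proof (induction S rule: finite_induct)
  case (insert z S)
  then obtain N M where "N > 0" "\<forall>p. prime p \<longrightarrow> \<not> p dvd N \<longrightarrow> S \<subseteq> multiplier_ring p"
    "M > 0" "\<forall>p. prime p \<longrightarrow> \<not> p dvd M \<longrightarrow> z \<in> multiplier_ring p"
    using denominator_multiplier_ring[of z] by auto
  then have "N * M > 0" "\<forall>p. prime p \<longrightarrow> \<not> p dvd N * M \<longrightarrow> insert z S \<subseteq> multiplier_ring p"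
    by (auto simp: prime_dvd_mult_iff)
  then show ?case by blast
qed auto

text \<open>The form \<open>coord b0 (z * w)\<close> is nondegenerate because \<open>K\<close> is a
  field: the product of \<open>z\<close> and \<open>inverse z * b0\<close> has
  \<open>b0\<close>-coordinate 1. Its dual basis lets a single functional express all
  coordinates.\<close>

lemma dual_basis_exists:
  assumes "b0 \<in> B"
  shows "\<exists>d. \<forall>b\<in>B. d b \<in> K \<and> (\<forall>z\<in>K. coord b z = coord b0 (z * d b))"
proof -
  \<comment> \<open>\<open>T\<close> is the map from \<open>K\<close> to its dual given by this
    form, the dual being identified with \<open>K\<close> through \<open>B\<close>. Surjectivity
    follows from injectivity by counting dimensions.\<close>
  define T where "T z = (\<Sum>b\<in>B. of_rat (coord b0 (z * b)) * b)" for z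
  interpret vp: vector_space_pair "\<lambda>(q::rat) (x::'a). of_rat q * x" "\<lambda>(q::rat) (x::'a). of_rat q * x"
    by unfold_locales
  have coord_T: "coord b (T z) = coord b0 (z * b)" if "b \<in> B" for b z
    using that finite_B unfolding T_def
    by (simp add: coord_sum coord_scale coord_basis if_distrib[of "\<lambda>x. _ * x"] sum.delta cong: if_cong)
  have TK: "T z \<in> K" for z
    unfolding T_def span_B[symmetric]
    by (intro rat_vs.span_sum rat_vs.span_scale rat_vs.span_base)
  have lin: "Vector_Spaces.linear (\<lambda>(q::rat) (x::'a). of_rat q * x) (\<lambda>(q::rat) (x::'a). of_rat q * x) T"
    by unfold_locales
      (simp_all add: T_def distrib_right coord_add of_rat_add sum.distrib mult.assoc coord_scale
        of_rat_mult sum_distrib_left)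
  have nondeg: "z = 0" if z: "z \<in> K" and T: "T z = 0" for z
  proof (rule ccontr)
    assume z0: "z \<noteq> 0"
    have "inverse z * b0 \<in> K" using z assms B_subset_K K_closed by blast
    from coord_mult_expand[OF this, of b0 z]
    have "coord b0 (z * (inverse z * b0)) = 0"
      using coord_T[of _ z] T by simp
    then show False
      using z0 assms by (simp add: coord_basis flip: mult.assoc)
  qed
  have inj: "inj_on T (rat_vs.span B)"
  proof (rule inj_onI)
    fix x y assume xy: "x \<in> rat_vs.span B" "y \<in> rat_vs.span B" "T x = T y"
    have "T (x - y) = 0"
      using vp.linear_diff[OF lin, of x y] xy(3) by simp
    moreover have "x - y \<in> K" using xy rat_vs.span_diff span_B by blast
    ultimately show "x = y" using nondeg by fastforce
  qed
  have ind: "rat_vs.independent (T ` B)"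
    using vp.linear_independent_injective_image[OF lin indep_B inj] .
  have surj: "v \<in> T ` K" if v: "v \<in> K" for v
  proof (rule ccontr)
    assume "v \<notin> T ` K"
    then have nv: "v \<notin> rat_vs.span (T ` B)"
      using vp.linear_span_image[OF lin, of B] span_B by simp
    then have "rat_vs.independent (insert v (T ` B))"
      using ind rat_vs.independent_insertI by blast
    moreover have "insert v (T ` B) \<subseteq> rat_vs.span B"
      using v TK span_B by blast
    ultimately have "card (insert v (T ` B)) \<le> card B"
      using rat_vs.independent_span_bound[OF finite_B] by blast
    moreover have "v \<notin> T ` B" using nv rat_vs.span_base by blast
    moreover have "card (T ` B) = card B"
      using card_image inj inj_on_subset rat_vs.span_superset by metis
    ultimately show False using finite_B by simp
  qed
  have "\<exists>d. d \<in> K \<and> (\<forall>z\<in>K. coord b z = coord b0 (z * d))" if b: "b \<in> B" for b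
  proof -
    from surj[OF B_subset_K[OF b]] obtain d where d: "d \<in> K" "T d = b" by auto
    have "coord b z = coord b0 (z * d)" if z: "z \<in> K" for z
    proof -
      have "coord b0 (z * d) = (\<Sum>c\<in>B. coord c z * coord b0 (d * c))"
        using coord_mult_expand[OF z, of b0 d] by (simp add: mult.commute)
      also have "\<dots> = (\<Sum>c\<in>B. coord c z * coord c b)"
        using coord_T[of _ d] d(2) by simp
      also have "\<dots> = coord b z"
        using b finite_B by (simp add: coord_basis if_distrib[of "\<lambda>x. _ * x"] sum.delta cong: if_cong)
      finally show ?thesis by simp
    qed
    then show ?thesis using d by blast
  qed
  then show ?thesis by metis
qed

text \<open>With \<open>\<Sum> b \<otimes> d b\<close> as
  Casimir element, averaging turns a generalised inverse of multiplication by \<open>a\<close> modulo \<open>p\<close> into a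
  multiplication map, and then \<open>a\<close> is a multiple of \<open>a\<^sup>2\<close> modulo \<open>p\<close>.\<close>

lemma multiplier_ring_reduced:
  "\<exists>N>0. \<forall>p. prime p \<longrightarrow> \<not> p dvd N \<longrightarrow> (\<forall>a\<in>multiplier_ring p. \<forall>w\<in>multiplier_ring p.
     a\<^sup>2 = of_nat p * w \<longrightarrow> a / of_nat p \<in> multiplier_ring p)"
proof -
  obtain b0 where b0: "b0 \<in> B" using B_nonempty by blast
  from dual_basis_exists[OF b0] obtain d where dK: "\<And>b. b \<in> B \<Longrightarrow> d b \<in> K"
    and dual: "\<And>b z. b \<in> B \<Longrightarrow> z \<in> K \<Longrightarrow> coord b z = coord b0 (z * d b)" by blast
  \<comment> \<open>The Casimir element multiplied out. Multiplication by \<open>cas\<close> turns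
    \<open>coord b0\<close> into the trace of \<open>K\<close> over the rationals, so
    \<open>cas\<close> is nonzero because the trace of 1 is the degree.\<close>
  define cas where "cas = (\<Sum>b\<in>B. b * d b)"
  have casK: "cas \<in> K"
    unfolding cas_def span_B[symmetric]
    by (rule rat_vs.span_sum) (use dK B_subset_K span_B K_closed in auto)
  have "coord b0 cas = (\<Sum>b\<in>B. coord b b)"
    unfolding cas_def coord_sum using dual B_subset_K by simp
  also have "\<dots> = of_nat (card B)"
    by (simp add: coord_basis)
  finally have cas0: "cas \<noteq> 0"
    using B_nonempty finite_B by auto
  \<comment> \<open>Integrality of the inverse of \<open>cas\<close>, together with that of the
    basis and its dual, is what excludes the ramified primes.\<close>
  have "finite (insert (inverse cas) (B \<union> d ` B))" "insert (inverse cas) (B \<union> d ` B) \<subseteq> K"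
    using finite_B dK B_subset_K casK K_closed by auto
  from denominator_multiplier_ring_finite[OF this] obtain N where N: "N > 0"
    "\<And>p. prime p \<Longrightarrow> \<not> p dvd N \<Longrightarrow> insert (inverse cas) (B \<union> d ` B) \<subseteq> multiplier_ring p" by blast
  \<comment> \<open>Clearing the coordinates of 1 makes the coordinates of every multiplier
    integral, as \<open>z = 1 * z\<close>.\<close>
  have "finite ((\<lambda>b. coord b 1) ` B)" using finite_B by simp
  from common_denominator[OF this] obtain M where M: "M > 0" "\<And>b. b \<in> B \<Longrightarrow> of_nat M * coord b 1 \<in> \<int>"
    by auto
  have "a / of_nat p \<in> multiplier_ring p"
    if p: "prime p" and NM: "\<not> p dvd N * M" and a: "a \<in> multiplier_ring p"
      and w: "w \<in> multiplier_ring p" and aw: "a\<^sup>2 = of_nat p * w" for p a w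
  proof -
    define A where "A = multiplier_ring p"
    note cl = multiplier_ring_closed[OF p, folded A_def]
    note sumA = sum_multiplier_ring[OF p, folded A_def]
    have "\<not> p dvd N" "\<not> p dvd M" using NM by auto
    then have icA: "inverse cas \<in> A" and BA: "\<And>b. b \<in> B \<Longrightarrow> b \<in> A" and dA: "\<And>b. b \<in> B \<Longrightarrow> d b \<in> A"
      using N(2)[OF p] by (auto simp: A_def)
    have one: "coord b 1 \<in> local_ints p" if "b \<in> B" for b
      using M(2)[OF that] local_intsI[OF \<open>\<not> p dvd M\<close>] by blast
    have AK: "z \<in> K" if "z \<in> A" for z using that by (simp add: A_def multiplier_ring_def)
    have coordA: "coord c z \<in> local_ints p" if "z \<in> A" "c \<in> B" for c z
      using coord_mult_expand[of 1 c z] that one K_closed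
      by (auto simp: A_def multiplier_ring_def intro!: sum_local_ints[OF p] local_ints_closed[OF p])
    have A0: "0 \<in> A" using sumA[of "{}"] by simp
    have umA: "- z \<in> A" if "z \<in> A" for z
      using cl(4)[OF _ that, of "-1"] Ints_local_ints[OF p, of "-1"] by simp
    have p0: "(of_nat p :: 'a) \<noteq> 0" using p by auto
    \<comment> \<open>The functionals \<open>coord i (a * y)\<close> are the rows of multiplication
      by \<open>a\<close>. The section vectors define the linear map \<open>S\<close> below, with
      \<open>a * S (a * y) = a * y\<close> modulo \<open>p\<close>.\<close>
    have "\<exists>s. (\<forall>i\<in>B. s i \<in> A) \<and> (\<forall>i\<in>B. \<forall>y\<in>A.
      (coord i (a * (\<Sum>l\<in>B. of_rat (coord l (a * y)) * s l)) - coord i (a * y)) / of_nat p \<in> local_ints p)"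
      using functionals_regular[OF p finite_B cl(2) cl(4) A0, of "\<lambda>i y. coord i (a * y)"]
        coordA cl(3) a unfolding A_def[symmetric]
      by (simp add: distrib_left coord_add mult.left_commute[of a] coord_scale)
    then obtain s where s: "\<And>i. i \<in> B \<Longrightarrow> s i \<in> A" and reg: "\<And>i y. i \<in> B \<Longrightarrow> y \<in> A \<Longrightarrow>
      (coord i (a * (\<Sum>l\<in>B. of_rat (coord l (a * y)) * s l)) - coord i (a * y)) / of_nat p \<in> local_ints p"
      by blast
    define S where "S z = (\<Sum>l\<in>B. of_rat (coord l z) * s l)" for z
    have SA: "S z \<in> A" if "z \<in> A" for z
      unfolding S_def by (rule sumA, rule cl(4)) (use that coordA s in auto)
    have S_scale: "S (of_rat r * z) = of_rat r * S z" for r z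
      by (simp add: S_def coord_scale of_rat_mult sum_distrib_left mult.assoc)
    have S_sum: "S (sum g J) = (\<Sum>j\<in>J. S (g j))" for g and J :: "'a set"
      unfolding S_def coord_sum of_rat_sum sum_distrib_right by (rule sum.swap)
    have delta: "(a * S (a * y) - a * y) / of_nat p \<in> A" if y: "y \<in> A" for y
    proof -
      have K: "a * S (a * y) - a * y \<in> K"
        using cl(2)[OF cl(3)[OF _ SA] umA[OF cl(3)], of a "a * y" a y] cl(3) a y AK unfolding A_def[symmetric]
        by simp
      have "(a * S (a * y) - a * y) / of_nat p
          = (\<Sum>b\<in>B. of_rat (coord b (a * S (a * y) - a * y) / of_nat p) * b)"
        by (subst coord_expand[OF K]) (simp add: sum_divide_distrib of_rat_divide)
      also have "\<dots> \<in> A"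
        by (rule sumA, rule cl(4)) (use reg y BA in \<open>auto simp: S_def coord_diff\<close>)
      finally show ?thesis .
    qed
    have dual_expand: "z = (\<Sum>c\<in>B. of_rat (coord b0 (z * c)) * d c)" if z: "z \<in> K" for z
    proof -
      define y where "y = (\<Sum>c\<in>B. of_rat (coord b0 (z * c)) * d c)"
      have yK: "y \<in> K"
        unfolding y_def span_B[symmetric]
        by (rule rat_vs.span_sum) (use dK of_rat_in_K span_B in auto)
      have "coord b0 (y * c) = coord b0 (z * c)" if c: "c \<in> B" for c
      proof -
        have "coord b0 (y * c) = (\<Sum>e\<in>B. coord b0 (z * e) * coord b0 (c * d e))"
          by (simp add: y_def sum_distrib_right coord_sum mult.assoc coord_scale mult.commute[of c])
        also have "\<dots> = (\<Sum>e\<in>B. coord b0 (z * e) * coord e c)"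
          using dual[OF _ B_subset_K[OF c]] by simp
        also have "\<dots> = coord b0 (z * c)"
          using c finite_B by (simp add: coord_basis if_distrib[of "\<lambda>x. _ * x"] sum.delta cong: if_cong)
        finally show ?thesis .
      qed
      then have "coord b y = coord b z" if "b \<in> B" for b
        using dual[OF that yK] dual[OF that z] coord_mult_expand[OF dK[OF that]] by simp
      then show ?thesis
        using coord_eqI[OF yK z] by (simp add: y_def)
    qed
    \<comment> \<open>If \<open>S\<close> were multiplication by some \<open>r\<close>, then
      \<open>t\<close> would be \<open>r * cas\<close>; in general \<open>t\<close> is the average
      that replaces \<open>S\<close> by a multiplication.\<close>
    define t where "t = (\<Sum>b\<in>B. b * S (d b))"
    have tA: "t \<in> A"
      unfolding t_def by (rule sumA, rule cl(3)) (use BA SA dA in auto)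
    have aK: "a \<in> K" using a AK by (simp add: A_def)
    \<comment> \<open>Invariance of the Casimir element: the factor \<open>a\<close> moves from
      \<open>d b\<close> to \<open>b\<close> across the tensor sign, although \<open>S\<close> is
      linear only over the rationals.\<close>
    have "(\<Sum>b\<in>B. b * S (a * d b)) = (\<Sum>b\<in>B. \<Sum>c\<in>B. b * (of_rat (coord b (a * c)) * S (d c)))"
    proof (rule sum.cong[OF refl])
      fix b assume b: "b \<in> B"
      have "coord b0 (a * d b * c) = coord b (a * c)" if "c \<in> B" for c
        using dual[OF b, of "a * c"] aK B_subset_K[OF that] K_closed by (simp add: ac_simps)
      then have "a * d b = (\<Sum>c\<in>B. of_rat (coord b (a * c)) * d c)"
        using dual_expand[of "a * d b"] aK dK[OF b] K_closed by simp
      then show "b * S (a * d b) = (\<Sum>c\<in>B. b * (of_rat (coord b (a * c)) * S (d c)))"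
        by (simp add: S_sum S_scale sum_distrib_left)
    qed
    also have "\<dots> = (\<Sum>c\<in>B. (\<Sum>b\<in>B. of_rat (coord b (a * c)) * b) * S (d c))"
      by (subst sum.swap) (simp add: sum_distrib_right sum_distrib_left ac_simps)
    also have "\<dots> = (\<Sum>c\<in>B. a * c * S (d c))"
      by (rule sum.cong) (use coord_expand aK B_subset_K K_closed in \<open>auto simp flip: coord_expand\<close>)
    also have "\<dots> = a * t"
      by (simp add: t_def sum_distrib_left mult.assoc)
    finally have lin: "(\<Sum>b\<in>B. b * S (a * d b)) = a * t" .
    define \<delta> where "\<delta> b = (a * S (a * d b) - a * d b) / of_nat p" for b
    \<comment> \<open>The left side is divisible by \<open>p\<close> because \<open>a^2\<close> is,
      and the right side is \<open>a * cas\<close> modulo \<open>p\<close>.\<close>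
    have "a\<^sup>2 * t = a * (\<Sum>b\<in>B. b * S (a * d b))"
      by (simp add: lin power2_eq_square)
    also have "\<dots> = (\<Sum>b\<in>B. b * (a * d b + of_nat p * \<delta> b))"
      unfolding \<delta>_def sum_distrib_left using p0 by (simp add: ac_simps)
    also have "\<dots> = a * cas + of_nat p * (\<Sum>b\<in>B. b * \<delta> b)"
      by (simp add: distrib_left sum.distrib cas_def sum_distrib_left ac_simps)
    finally have "a * cas = of_nat p * (w * t + - (\<Sum>b\<in>B. b * \<delta> b))"
      unfolding aw by (simp add: algebra_simps)
    then have "a / of_nat p = inverse cas * (w * t + - (\<Sum>b\<in>B. b * \<delta> b))"
      using cas0 p0 by (simp add: field_simps)
    also have "\<dots> \<in> A"
    proof -
      have "(\<Sum>b\<in>B. b * \<delta> b) \<in> A"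
        by (rule sumA, rule cl(3)) (use BA dA delta in \<open>auto simp: \<delta>_def\<close>)
      then show ?thesis
        using w by (intro cl(2,3) icA tA umA) (auto simp: A_def)
    qed
    finally show ?thesis by (simp add: A_def)
  qed
  moreover have "N * M > 0" using N M by simp
  ultimately show ?thesis by blast
qed

text \<open>The substitute for the fact that squares have even valuation. The least power of
  \<open>p\<close> that makes \<open>y\<close> integral yields an element whose square lies in
  \<open>p A\<close>, so by \<open>red\<close> a further \<open>p\<close> divides out. Minimality
  forces the power to be trivial; then \<open>y / p\<close> is integral and its square is
  \<open>u / p\<close>.\<close>

lemma multiplier_ring_square:
  assumes p: "prime p"
    and red: "\<And>a w. a \<in> multiplier_ring p \<Longrightarrow> w \<in> multiplier_ring p \<Longrightarrow> a\<^sup>2 = of_nat p * w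
      \<Longrightarrow> a / of_nat p \<in> multiplier_ring p"
    and u: "u \<in> multiplier_ring p" and y: "y \<in> K" "y\<^sup>2 = of_nat p * u"
  shows "u / of_nat p \<in> multiplier_ring p"
proof -
  note cl = multiplier_ring_closed[OF p]
  have p0: "(of_nat p :: 'a) \<noteq> 0" using p by auto
  have pA: "of_nat p ^ n \<in> multiplier_ring p" for n
    using cl(4)[OF _ cl(1), of "of_nat p ^ n"] Ints_local_ints[OF p, of "of_nat p ^ n"]
    by (simp add: of_rat_power)
  obtain N where N: "N > 0" "of_nat N * y \<in> multiplier_ring p"
    using denominator_multiplier_ring[OF y(1)] p by blast
  obtain k m where km: "N = p ^ k * m" "\<not> p dvd m"
    using N(1) p by (metis multiplicity_decompose' not_prime_unit not_gr_zero)
  have m0: "(of_nat m :: 'a) \<noteq> 0" using km N by auto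
  have "1 / of_nat m \<in> local_ints p"
    by (rule local_intsI[OF km(2)]) (use m0 in auto)
  from cl(4)[OF this N(2)] have "\<exists>k. of_nat p ^ k * y \<in> multiplier_ring p"
    using m0 unfolding km by (intro exI[of _ k]) (simp add: of_rat_divide)
  define n where "n = (LEAST k. of_nat p ^ k * y \<in> multiplier_ring p)"
  have n: "of_nat p ^ n * y \<in> multiplier_ring p"
    unfolding n_def using \<open>\<exists>k. _\<close> by (rule LeastI_ex)
  have n': "of_nat p ^ n * y / of_nat p \<in> multiplier_ring p"
    by (rule red[OF n, of "of_nat p ^ n * of_nat p ^ n * u"])
      (use cl(3)[OF cl(3)[OF pA pA] u] y(2) in \<open>auto simp: power_mult_distrib power2_eq_square\<close>)
  have "n = 0"
  proof (cases n)
    case (Suc j)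
    then have "of_nat p ^ j * y \<in> multiplier_ring p" using n' p0 by simp
    then have "n \<le> j" unfolding n_def by (rule Least_le)
    then show ?thesis using Suc by simp
  qed
  then have "y / of_nat p \<in> multiplier_ring p" using n' by simp
  from cl(3)[OF this this] show ?thesis
    using y(2) p0 by (simp add: power2_eq_square)
qed

end

text \<open>For each prime \<open>p\<close> the ring \<open>A p\<close> plays the role of the localisation at \<open>p\<close> of an order of \<open>K\<close>;
  the last clause says that almost all primes are unramified.\<close>

theorem number_field_local_rings:
  fixes K :: "'a::field_char_0 set"
  assumes "number_field K"
  obtains A :: "nat \<Rightarrow> 'a set" where
    "\<And>p. prime p \<Longrightarrow> 0 \<in> A p" "\<And>p. prime p \<Longrightarrow> 1 \<in> A p"
    "\<And>p x y. prime p \<Longrightarrow> x \<in> A p \<Longrightarrow> y \<in> A p \<Longrightarrow> x + y \<in> A p"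
    "\<And>p x y. prime p \<Longrightarrow> x \<in> A p \<Longrightarrow> y \<in> A p \<Longrightarrow> x * y \<in> A p"
    "\<And>p x. prime p \<Longrightarrow> x \<in> A p \<Longrightarrow> - x \<in> A p"
    "\<And>p. prime p \<Longrightarrow> inverse (of_nat p) \<notin> A p"
    "\<And>z. z \<in> K \<Longrightarrow> \<exists>N>0. \<forall>p. prime p \<longrightarrow> of_nat N * z \<in> A p \<and> (\<not> p dvd N \<longrightarrow> z \<in> A p)"
    "\<exists>N>0. \<forall>p. prime p \<longrightarrow> \<not> p dvd N \<longrightarrow>
       (\<forall>u\<in>A p. \<forall>y\<in>K. y\<^sup>2 = of_nat p * u \<longrightarrow> u / of_nat p \<in> A p)"
proof -
  obtain S where S: "is_subfield K" "finite S" "K = rat_vs.span S"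
    using assms by (auto simp: number_field_def)
  obtain B where B: "B \<subseteq> S" "rat_vs.independent B" "S \<subseteq> rat_vs.span B"
    using rat_vs.maximal_independent_subset by metis
  have "rat_vs.span B = K"
    using B S(3) rat_vs.span_mono[OF B(1)] rat_vs.span_minimal[OF B(3) rat_vs.subspace_span] by blast
  then interpret number_field_basis K B
    using B S finite_subset by (intro number_field_basis.intro) auto
  show ?thesis
  proof (rule that[of multiplier_ring])
    show "0 \<in> multiplier_ring p" if "prime p" for p
      using sum_multiplier_ring[OF that, of "{}"] by simp
    show "- x \<in> multiplier_ring p" if "prime p" "x \<in> multiplier_ring p" for p x
      using multiplier_ring_closed(4)[OF that(1) _ that(2), of "-1"] Ints_local_ints[OF that(1), of "-1"]
      by simp
    show "\<exists>N>0. \<forall>p. prime p \<longrightarrow> \<not> p dvd N \<longrightarrow>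
       (\<forall>u\<in>multiplier_ring p. \<forall>y\<in>K. y\<^sup>2 = of_nat p * u \<longrightarrow> u / of_nat p \<in> multiplier_ring p)"
      using multiplier_ring_reduced multiplier_ring_square by meson
  qed (simp_all add: multiplier_ring_closed inverse_prime_not_multiplier_ring denominator_multiplier_ring)
qed

section \<open>Rank and points of infinite order\<close>

lemma (in comm_group) finprod_in_subgroup:
  assumes H: "subgroup H G" and g: "\<And>i. i \<in> I \<Longrightarrow> g i \<in> H"
  shows "finprod G g I \<in> H"
  using g
proof (induction I rule: infinite_finite_induct)
  case (insert i I)
  then have "g ` insert i I \<subseteq> carrier G"
    using subgroup.subset[OF H] by blast
  then have "finprod G g (insert i I) = g i \<otimes> finprod G g I"
    using insert.hyps by (intro finprod_insert) auto
  then show ?case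
    using insert subgroup.m_closed[OF H] by simp
qed (use subgroup.one_closed[OF H] in auto)

text \<open>The factor with the largest index is the inverse of a product lying in its subgroup
  \<open>H\<close>, so \<open>ind\<close> kills its exponent; induction strips the factors off from
  the top.\<close>

lemma (in comm_group) finprod_int_pow_eq_one:
  fixes P :: "nat \<Rightarrow> 'a" and H :: "nat \<Rightarrow> 'a set"
  assumes H: "\<And>n. subgroup (H n) G"
    and P: "\<And>n. P n \<in> carrier G" "\<And>i n. i < n \<Longrightarrow> P i \<in> H n"
    and ind: "\<And>n k. k \<noteq> 0 \<Longrightarrow> P n [^] (k::int) \<notin> H n"
    and "finprod G (\<lambda>i. P i [^] (e i :: int)) {..<N} = \<one>"
  shows "\<forall>i<N. e i = 0"
  using assms(5)
proof (induction N)
  case (Suc N)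
  define Q where "Q = finprod G (\<lambda>i. P i [^] e i) {..<N}"
  have QH: "Q \<in> H N"
    unfolding Q_def using P by (intro finprod_in_subgroup[OF H] subgroup_int_pow_closed[OF H]) auto
  then have Q: "Q \<in> carrier G" using subgroup.subset[OF H] by blast
  have "finprod G (\<lambda>i. P i [^] e i) {..<Suc N} = P N [^] e N \<otimes> Q"
    unfolding Q_def lessThan_Suc using P by (intro finprod_insert) auto
  then have *: "P N [^] e N \<otimes> Q = \<one>" using Suc.prems by simp
  then have "P N [^] e N = inv Q"
    using Q P by (metis inv_equality int_pow_closed)
  then have "P N [^] e N \<in> H N"
    using subgroup.m_inv_closed[OF H QH] by simp
  then have eN: "e N = 0" using ind by blast
  then have "Q = \<one>" using * Q by simp
  then show ?case
    using Suc.IH eN unfolding Q_def by (simp add: less_Suc_eq)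
qed simp

lemma (in comm_group) rank_infinite:
  fixes P :: "nat \<Rightarrow> 'a" and H :: "nat \<Rightarrow> 'a set"
  assumes H: "\<And>n. subgroup (H n) G"
    and P: "\<And>n. P n \<in> carrier G" "\<And>i n. i < n \<Longrightarrow> P i \<in> H n"
    and ind: "\<And>n k. k \<noteq> 0 \<Longrightarrow> P n [^] (k::int) \<notin> H n"
  shows "abelian_group_rank G = \<infinity>"
proof -
  have "P n \<notin> H n" for n
    using ind[of 1 n] P(1) by simp
  then have inj: "inj P"
    using P(2) by (metis linorder_injI)
  have "int_independent G (P ` {..<N})" for N
  proof -
    have "\<forall>x\<in>P ` {..<N}. n x = 0"
      if "finprod G (\<lambda>x. x [^] n x) (P ` {..<N}) = \<one>" for n :: "'a \<Rightarrow> int"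
    proof -
      have "finprod G (\<lambda>i. P i [^] n (P i)) {..<N} = \<one>"
        using that P inj by (subst (asm) finprod_reindex) (auto intro: inj_on_subset)
      from finprod_int_pow_eq_one[OF H P ind this] show ?thesis by auto
    qed
    then show ?thesis using P by (auto simp: int_independent_def)
  qed
  then have "enat N \<le> abelian_group_rank G" for N
    unfolding abelian_group_rank_def
    by (intro SUP_upper2[of "P ` {..<N}"]) (auto simp: card_image inj_on_subset[OF inj])
  then show ?thesis
    by (metis enat_ord_simps(4) enat_ord_simps(2) enat.exhaust lessI not_less)
qed

text \<open>An element of finite order has only finitely many powers, so infinitely many distinct
  iterated doublings rule out torsion.\<close>

lemma (in group) int_pow_neq_one_of_inj_doublings:
  assumes P: "P \<in> carrier G" and inj: "inj (\<lambda>k. P [^] (2 ^ k :: nat))" and m: "m \<noteq> 0"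
  shows "P [^] (m::int) \<noteq> \<one>"
proof
  assume 1: "P [^] m = \<one>"
  define n where "n = nat \<bar>m\<bar>"
  have n: "n > 0" using m by (simp add: n_def)
  have "P [^] (int n) = \<one>"
    using 1 P by (cases "m \<ge> 0") (simp_all add: n_def int_pow_neg)
  then have Pn: "P [^] n = \<one>" by (simp add: int_pow_int)
  have "P [^] (2 ^ k :: nat) \<in> (\<lambda>j. P [^] j) ` {..<n}" for k :: nat
  proof -
    have "P [^] (n * (2 ^ k div n)) = \<one>"
      using nat_pow_pow[OF P, of n "2 ^ k div n"] Pn by simp
    then have "P [^] (n * (2 ^ k div n) + 2 ^ k mod n) = P [^] (2 ^ k mod n)"
      using nat_pow_mult[OF P, of "n * (2 ^ k div n)" "2 ^ k mod n"] P by (metis l_one nat_pow_closed)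
    then have "P [^] (2 ^ k :: nat) = P [^] (2 ^ k mod n)" by simp
    then show ?thesis using n by (intro image_eqI[of _ _ "2 ^ k mod n"]) auto
  qed
  then have "range (\<lambda>k. P [^] (2 ^ k :: nat)) \<subseteq> (\<lambda>j. P [^] j) ` {..<n}"
    by (rule image_subsetI)
  then have "finite (range (\<lambda>k. P [^] (2 ^ k :: nat)))"
    by (rule finite_subset) simp
  then show False
    using finite_imageD[OF _ inj] infinite_UNIV_nat by simp
qed

section \<open>Infinite order from the growth of denominators at 2\<close>

locale odd_ring =
  fixes A :: "'a::field_char_0 set"
  assumes A0: "0 \<in> A" and A1: "1 \<in> A" and A_add: "x \<in> A \<Longrightarrow> y \<in> A \<Longrightarrow> x + y \<in> A"
    and A_mult: "x \<in> A \<Longrightarrow> y \<in> A \<Longrightarrow> x * y \<in> A" and A_uminus: "x \<in> A \<Longrightarrow> - x \<in> A"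
    and half: "inverse 2 \<notin> A"
begin

definition evens :: "'a set" where "evens = (\<lambda>z. 2 * z) ` A"
text \<open>The ideal \<open>evens\<close> need not be prime, so odd means congruent to 1 modulo 2
  rather than not even. This coset is closed under products, and it misses \<open>evens\<close>
  because \<open>1/2\<close> is not in \<open>A\<close>.\<close>

definition odds :: "'a set" where "odds = {z. z - 1 \<in> evens}"

lemma evensI: "z \<in> A \<Longrightarrow> 2 * z \<in> evens"
  by (simp add: evens_def)

lemma evensE: "x \<in> evens \<Longrightarrow> (\<And>z. z \<in> A \<Longrightarrow> x = 2 * z \<Longrightarrow> Q) \<Longrightarrow> Q"
  unfolding evens_def by (erule imageE)

lemma evens_add: "x \<in> evens \<Longrightarrow> y \<in> evens \<Longrightarrow> x + y \<in> evens"
  by (elim evensE) (simp only: distrib_left[symmetric] evensI A_add)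

lemma evens_uminus: "x \<in> evens \<Longrightarrow> - x \<in> evens"
  by (elim evensE) (simp only: mult_minus_right[symmetric] evensI A_uminus)

lemma evens_mult: "x \<in> A \<Longrightarrow> y \<in> evens \<Longrightarrow> x * y \<in> evens"
  by (elim evensE) (simp only: mult.left_commute[of x] evensI A_mult)

lemma evens_subset: "x \<in> evens \<Longrightarrow> x \<in> A"
  by (elim evensE) (simp only: mult_2 A_add)

lemma odds_subset:
  assumes "x \<in> odds" shows "x \<in> A"
proof -
  have "(x - 1) + 1 \<in> A"
    using assms by (intro A_add evens_subset A1) (simp add: odds_def)
  then show ?thesis by simp
qed

lemma one_odd: "1 \<in> odds"
  unfolding odds_def using evensI[OF A0] by simp

lemma odds_add_even:
  assumes "x \<in> odds" "y \<in> evens" shows "x + y \<in> odds"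
proof -
  have "x + y - 1 = (x - 1) + y" by simp
  also have "\<dots> \<in> evens" using assms by (intro evens_add) (simp_all add: odds_def)
  finally show ?thesis by (simp add: odds_def)
qed

lemma odds_mult:
  assumes "x \<in> odds" "y \<in> odds" shows "x * y \<in> odds"
proof -
  have "x * y = x + x * (y - 1)" by (simp add: algebra_simps)
  also have "\<dots> \<in> odds"
    using assms by (intro odds_add_even evens_mult odds_subset) (simp_all add: odds_def)
  finally show ?thesis .
qed

lemma odds_power: "x \<in> odds \<Longrightarrow> x ^ n \<in> odds"
  by (induction n) (auto intro: one_odd odds_mult)

lemma not_odd_even: "x \<in> odds \<Longrightarrow> x \<in> evens \<Longrightarrow> False"
proof -
  assume "x \<in> odds" "x \<in> evens"
  then have "- (x - 1) + x \<in> evens" unfolding odds_def by (intro evens_add evens_uminus) auto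
  then have "1 \<in> evens" by simp
  then obtain z where "z \<in> A" "1 = 2 * z" by (rule evensE)
  then have "z = inverse 2" by (metis inverse_unique)
  then show False using half \<open>z \<in> A\<close> by metis
qed

lemma zero_not_odd: "0 \<notin> odds"
  using not_odd_even[of 0] evensI[OF A0] by auto

end

locale cubic_odd_ring = nonsingular_cubic a b c + odd_ring A
  for a b c :: "'a::{field_char_0, alg_closed_field}" and A :: "'a set" +
  fixes t :: 'a
  assumes t: "t \<noteq> 0" "t \<in> evens" "t * a \<in> evens" "t * b \<in> evens" "t * c \<in> evens"
begin

text \<open>The duplication formula gives the new abscissa as
  \<open>(x^4 - 2 b x^2 - 8 c x + b^2 - 4 a c) / (4 f x)\<close>. For \<open>x = s / T\<close>,
  clearing denominators turns the numerator into \<open>s^4\<close> and \<open>f x\<close> into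
  \<open>s^3\<close>, each plus terms containing one of \<open>T a\<close>, \<open>T b\<close>,
  \<open>T c\<close>, which are even because \<open>T\<close> is a multiple of
  \<open>t\<close>.\<close>

lemma double_odd_over_even:
  assumes P: "y\<^sup>2 = f x" and x: "x = s / T" and s: "s \<in> odds"
    and T: "T = v * t" "v \<in> A" "T \<noteq> 0"
  shows "\<exists>n\<in>odds. \<exists>g\<in>odds. \<exists>y'. Affine x y \<boxplus> Affine x y = Affine (n / (4 * T * g)) y'"
proof -
  have TE: "T \<in> evens" "T * a \<in> evens" "T * b \<in> evens" "T * c \<in> evens"
    using t evens_mult[OF T(2)] unfolding T(1) by (auto simp: mult.assoc)
  note TA = TE[THEN evens_subset]
  have sA: "s \<in> A" using s by (rule odds_subset)
  have cA: "numeral k * z \<in> A" if "z \<in> A" for z k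
  proof -
    have "(of_nat m :: 'a) \<in> A" for m by (induction m) (auto intro: A0 A1 A_add)
    from this[of "numeral k"] show ?thesis using A_mult that by simp
  qed
  define g where "g = s ^ 3 + (s * s * (T * a) + s * T * (T * b) + T * T * (T * c))"
  have g: "g \<in> odds"
    unfolding g_def by (intro odds_add_even odds_power evens_add evens_mult A_mult s sA TA TE)
  define n where "n = s ^ 4 + (- ((2 * s * s * T) * (T * b) + (8 * s * T * T) * (T * c))
      + ((T * T * (T * b)) * (T * b) + - ((4 * T * T * (T * a)) * (T * c))))"
  have n: "n \<in> odds"
    unfolding n_def
    by (intro odds_add_even odds_power evens_add evens_mult evens_uminus A_mult cA s sA TA TE)
  have g': "f x = g / T ^ 3"
    using T(3) unfolding x cubic_def g_def by (simp add: field_simps power2_eq_square power3_eq_cube)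
  have g0: "g \<noteq> 0" using g zero_not_odd by auto
  then have fx: "f x \<noteq> 0" using g' T(3) by simp
  then have y: "y \<noteq> 0" using P by auto
  define l where "l = (3 * x\<^sup>2 + 2 * a * x + b) / (2 * y)"
  have l: "3 * x\<^sup>2 + 2 * a * x + b = 2 * y * l"
    using y by (simp add: l_def)
  have "(4 * f x) * (l\<^sup>2 - a - x - x) = (2 * y * l)\<^sup>2 - 4 * f x * (a + x + x)"
    unfolding P[symmetric] by (simp add: algebra_simps power2_eq_square)
  also have "\<dots> = x ^ 4 - 2 * b * x\<^sup>2 - 8 * c * x + b\<^sup>2 - 4 * a * c"
    unfolding l[symmetric] cubic_def
    by (simp add: algebra_simps power2_eq_square power3_eq_cube power4_eq_xxxx)
  also have "\<dots> = n / T ^ 4"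
    using T(3) unfolding x n_def by (simp add: field_simps power2_eq_square power4_eq_xxxx)
  finally have "(4 * f x) * (l\<^sup>2 - a - x - x) = n / T ^ 4" .
  then have "l\<^sup>2 - a - x - x = (n / T ^ 4) / (4 * f x)"
    using fx by (metis mult.commute nonzero_eq_divide_eq mult_eq_0_iff zero_neq_numeral)
  also have "\<dots> = n / (4 * T * g)"
    using T(3) g0 unfolding g' by (simp add: field_simps power3_eq_cube power4_eq_xxxx)
  finally have "Affine x y \<boxplus> Affine x y = Affine (n / (4 * T * g)) (- (y + l * (n / (4 * T * g) - x)))"
    using padd_tangent[OF y l refl] by simp
  then show ?thesis using n g by blast
qed

text \<open>After \<open>k\<close> doublings the abscissa is \<open>u / (4^k * w * t)\<close> with
  \<open>u\<close> and \<open>w\<close> odd. Equality at stages \<open>j < k\<close> would equate a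
  product of odd elements with a multiple of \<open>4 ^ (k - j)\<close>.\<close>

lemma iterated_doubling_inj:
  assumes P: "y\<^sup>2 = f x" "x = s / t" "s \<in> odds"
    and D: "D 0 = Affine x y" "\<And>k. D (Suc k) = D k \<boxplus> D k"
  shows "inj D"
proof -
  have D_form: "\<exists>u\<in>odds. \<exists>w\<in>odds. \<exists>y. D k = Affine (u / (4 ^ k * w * t)) y \<and> D k \<in> C" for k
  proof (induction k)
    case 0
    then show ?case using P D(1) one_odd by (intro bexI[of _ s] bexI[of _ 1]) auto
  next
    case (Suc k)
    then obtain u w y' where u: "u \<in> odds" "w \<in> odds" "D k = Affine (u / (4 ^ k * w * t)) y'" "D k \<in> C"
      by blast
    have four: "4 ^ k \<in> A"
    proof (induction k)
      case (Suc k)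
      have "(4::'a) = 1 + 1 + (1 + 1)" by simp
      also have "\<dots> \<in> A" by (intro A_add A1)
      finally show ?case using Suc A_mult by simp
    qed (simp add: A1)
    have w0: "w \<noteq> 0" using u zero_not_odd by auto
    have "y'\<^sup>2 = f (u / (4 ^ k * w * t))" using u by simp
    from double_odd_over_even[OF this refl u(1) refl A_mult[OF four odds_subset[OF u(2)]]] w0 t(1)
    obtain n g y'' where "n \<in> odds" "g \<in> odds" "D (Suc k) = Affine (n / (4 * (4 ^ k * w * t) * g)) y''"
      unfolding D(2) u(3) by auto
    moreover have "4 * (4 ^ k * w * t) * g = 4 ^ Suc k * (w * g) * t" by simp
    moreover have "D (Suc k) \<in> C" unfolding D(2) using padd_in_C u(4) by blast
    ultimately show ?case using odds_mult[OF u(2)] by metis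
  qed
  have ne: "D j \<noteq> D k" if jk: "j < k" for j k
  proof
    assume eq: "D j = D k"
    obtain u w y' where u: "u \<in> odds" "w \<in> odds" "D j = Affine (u / (4 ^ j * w * t)) y'"
      using D_form by blast
    obtain u' w' y'' where u': "u' \<in> odds" "w' \<in> odds" "D k = Affine (u' / (4 ^ k * w' * t)) y''"
      using D_form by blast
    have w0: "w \<noteq> 0" "w' \<noteq> 0" using u u' zero_not_odd by auto
    have "u / (4 ^ j * w * t) = u' / (4 ^ k * w' * t)" using eq u u' by simp
    then have "u * 4 ^ k * w' = u' * 4 ^ j * w"
      using w0 t(1) by (simp add: field_simps)
    moreover have "k = j + (k - j)" using jk by simp
    then have "(4::'a) ^ k = 4 ^ j * 4 ^ (k - j)" by (metis power_add)
    ultimately have eq2: "u * w' * 4 ^ (k - j) = u' * w" by (simp add: field_simps)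
    obtain m where m: "k - j = Suc m" using jk by (metis Suc_diff_Suc)
    have two: "2 * z \<in> A" if "z \<in> A" for z unfolding mult_2 using that that by (rule A_add)
    have four: "4 ^ m \<in> A"
    proof (induction m)
      case (Suc m)
      have "4 ^ Suc m = 2 * (2 * 4 ^ m :: 'a)" by simp
      then show ?case using two Suc by metis
    qed (simp add: A1)
    have "u * w' * 4 ^ (k - j) = 2 * (2 * (u * w' * 4 ^ m))" unfolding m by simp
    also have "\<dots> \<in> evens"
      by (intro evensI two A_mult four odds_subset u u')
    finally show False using eq2 odds_mult[OF u'(1) u(2)] not_odd_even by metis
  qed
  show ?thesis
    by (rule linorder_injI) (use ne in auto)
qed

end

section \<open>Independent points\<close>

text \<open>For \<open>d^2\<close> in \<open>F\<close>, the \<open>F\<close>-points of the quadratic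
  twist \<open>d^2 v^2 = f x\<close>, carried to the curve over \<open>F\<close> with
  \<open>d\<close> adjoined. The equation of the curve is imposed where the set is used.\<close>

definition twist_points :: "'a::field set \<Rightarrow> 'a \<Rightarrow> 'a ec_point set" where
  "twist_points F d = insert Infinity {Affine x (v * d) | x v. x \<in> F \<and> v \<in> F}"

lemma twist_points_add:
  fixes F :: "'a::field_char_0 set"
  assumes F: "is_subfield F" and ab: "a \<in> F" "b \<in> F" and d: "d\<^sup>2 \<in> F" "d \<noteq> 0"
    and P: "P \<in> twist_points F d" and Q: "Q \<in> twist_points F d"
  shows "ec_add (cubic_curve a b c) P Q \<in> twist_points F d"
proof (cases P; cases Q)
  fix x1 y1 x2 y2 assume PQ: "P = Affine x1 y1" "Q = Affine x2 y2"
  note cl = subfield_closed[OF F]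
  from P Q obtain v1 v2 where v: "x1 \<in> F" "v1 \<in> F" "y1 = v1 * d" "x2 \<in> F" "v2 \<in> F" "y2 = v2 * d"
    by (auto simp: twist_points_def PQ)
  show ?thesis
  proof (cases "x1 = x2 \<and> y1 + y2 = 0")
    case True
    then show ?thesis by (simp add: PQ twist_points_def)
  next
    case False
    define l where "l = (if x1 = x2 then (3 * x1\<^sup>2 + 2 * a * x1 + b) / (2 * y1) else (y2 - y1) / (x2 - x1))"
    \<comment> \<open>For \<open>v1 = 0\<close> in the tangent branch both quotients are divisions
      by zero with value 0, so \<open>l = m * d\<close> holds there as well.\<close>
    define m where "m = (if x1 = x2 then (3 * x1\<^sup>2 + 2 * a * x1 + b) / (2 * v1 * d\<^sup>2)
      else (v2 - v1) / (x2 - x1))"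
    have mF: "m \<in> F" unfolding m_def using v d ab by (auto intro!: cl)
    have l: "l = m * d"
      using d(2) by (cases "v1 = 0") (auto simp: l_def m_def v field_simps power2_eq_square)
    define x3 where "x3 = m\<^sup>2 * d\<^sup>2 - a - x1 - x2"
    have "ec_add (cubic_curve a b c) P Q
        = (let x3 = l\<^sup>2 - a - x1 - x2 in Affine x3 (- (l * x3) - (y1 - l * x1)))"
      using False unfolding PQ l_def by (simp add: Let_def)
    then have "ec_add (cubic_curve a b c) P Q = Affine x3 ((- (m * x3) - (v1 - m * x1)) * d)"
      unfolding x3_def l v(3) by (simp add: Let_def power_mult_distrib algebra_simps)
    moreover have "x3 \<in> F" unfolding x3_def using v d ab cl(11)[OF mF, of 2] by (intro cl(6,7)) auto
    moreover have "- (m * x3) - (v1 - m * x1) \<in> F" using v mF \<open>x3 \<in> F\<close> by (intro cl)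
    ultimately show ?thesis
      unfolding twist_points_def by blast
  qed
qed (use P Q in auto)

lemma twist_points_xneg:
  assumes "is_subfield F" "P \<in> twist_points F (d :: 'a::field_char_0)"
  shows "xneg P \<in> twist_points F d"
proof (cases P)
  case (Affine x y)
  then obtain v where v: "x \<in> F" "v \<in> F" "y = v * d"
    using assms by (auto simp: twist_points_def)
  have "- v \<in> F" using subfield_closed(9)[OF assms(1) v(2)] .
  moreover have "xneg P = Affine x (- v * d)" using v Affine by simp
  ultimately show ?thesis using v unfolding twist_points_def by blast
qed (simp add: twist_points_def)

section \<open>Towers of square roots\<close>

fun quadratic_tower :: "'a::field set \<Rightarrow> (nat \<Rightarrow> 'a) \<Rightarrow> nat \<Rightarrow> 'a set" where
  "quadratic_tower K y 0 = K"
| "quadratic_tower K y (Suc n) = quadratic_extension (quadratic_tower K y n) (y n)"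

lemma quadratic_tower_subfield:
  assumes K: "is_subfield K" and y: "\<And>i. (y i)\<^sup>2 \<in> K"
  shows "is_subfield (quadratic_tower K y n) \<and> K \<subseteq> quadratic_tower K y n"
proof (induction n)
  case (Suc n)
  then show ?case
    using y quadratic_extension_superset[of "quadratic_tower K y n" "y n"]
    by (auto intro!: quadratic_extension_subfield)
qed (simp add: K)

lemma quadratic_tower_generator:
  assumes K: "is_subfield K" and y: "\<And>i. (y i)\<^sup>2 \<in> K" and "i < n"
  shows "y i \<in> quadratic_tower K y n"
  using \<open>i < n\<close>
proof (induction n)
  case (Suc n)
  have "is_subfield (quadratic_tower K y n)"
    using quadratic_tower_subfield[where K = K and y = y, OF K y] by blast
  from quadratic_extension_superset[OF this, of "y n"] show ?case
    using Suc by (auto simp: less_Suc_eq)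
qed simp

text \<open>Kummer theory of exponent 2. For \<open>z = a + b * y n\<close> with square in
  \<open>K\<close> the mixed term \<open>2 a b\<close> vanishes, so \<open>z\<close> lies in the
  lower field already or after multiplication by \<open>y n\<close>. Stages at which
  \<open>y n\<close> adds nothing are covered.\<close>

lemma quadratic_tower_square:
  fixes K :: "'a::field_char_0 set"
  assumes K: "is_subfield K" and y: "\<And>i. (y i)\<^sup>2 \<in> K"
    and "z \<in> quadratic_tower K y n" "z\<^sup>2 \<in> K"
  shows "\<exists>S\<subseteq>{..<n}. z * (\<Prod>i\<in>S. y i) \<in> K"
  using assms(3,4)
proof (induction n arbitrary: z)
  case 0
  then show ?case by (intro exI[of _ "{}"]) auto
next
  case (Suc n)
  let ?F = "quadratic_tower K y n"
  have F: "is_subfield ?F" "K \<subseteq> ?F"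
    using quadratic_tower_subfield[where K = K and y = y, OF K y] by blast+
  obtain a b where ab: "a \<in> ?F" "b \<in> ?F" "z = a + b * y n"
    using Suc.prems(1) by (auto simp: quadratic_extension_def)
  note cl = subfield_closed[OF F(1)]
  have y2: "(y n)\<^sup>2 \<in> ?F" using y F by blast
  consider "z \<in> ?F" | "z = b * y n"
  proof (cases "y n \<in> ?F")
    case True
    then have "z \<in> ?F" unfolding ab(3) using ab by (intro cl)
    then show ?thesis using that by blast
  next
    case False
    have z2: "z\<^sup>2 \<in> ?F" using Suc.prems(2) F by blast
    have "z\<^sup>2 + 0 * y n = (a\<^sup>2 + b\<^sup>2 * (y n)\<^sup>2) + (2 * a * b) * y n"
      unfolding ab(3) by (simp add: algebra_simps power2_eq_square)
    from quadratic_extension_unique(2)[OF F(1) False z2 _ _ _ this] have "0 = 2 * a * b"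
      using ab y2 by (auto intro!: cl)
    then show ?thesis using that ab by auto
  qed
  then show ?case
  proof cases
    case 1
    from Suc.IH[OF this Suc.prems(2)] obtain S where "S \<subseteq> {..<n}" "z * (\<Prod>i\<in>S. y i) \<in> K" by blast
    then show ?thesis by (intro exI[of _ S]) auto
  next
    case 2
    have "z * y n = b * (y n)\<^sup>2" using 2 by (simp add: power2_eq_square mult.assoc)
    also have "\<dots> \<in> ?F" using ab y2 by (intro cl(7))
    finally have zF: "z * y n \<in> ?F" .
    have "(z * y n)\<^sup>2 \<in> K"
      unfolding power_mult_distrib using Suc.prems(2) y by (intro subfield_closed(7)[OF K])
    from Suc.IH[OF zF this] obtain S where S: "S \<subseteq> {..<n}" "z * y n * (\<Prod>i\<in>S. y i) \<in> K" by blast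
    have "n \<notin> S" "finite S" using S finite_subset[of S "{..<n}"] by auto
    then have "z * (\<Prod>i\<in>insert n S. y i) \<in> K" using S by (simp add: mult.assoc)
    then show ?thesis using S by (intro exI[of _ "insert n S"]) auto
  qed
qed

section \<open>Construction of the sequence of points\<close>

lemma (in involution) exists_independent_points:
  assumes K: "number_field K" and fixed: "\<And>z. z \<in> K \<Longrightarrow> \<sigma> z = z"
    and abc: "a \<in> K" "b \<in> K" "c \<in> K"
  obtains A T x y where "odd_ring A"
    "\<And>n. T n \<noteq> 0 \<and> {T n, T n * a, T n * b, T n * c} \<subseteq> odd_ring.evens A"
    "\<And>n. \<exists>s\<in>odd_ring.odds A. x n = s / T n" "\<And>n. x n \<in> K"
    "\<And>n. (y n)\<^sup>2 = cubic a b c (x n)" "\<And>n. \<sigma> (y n) = y n"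
    "\<And>n. y n \<notin> quadratic_tower K y n"
proof -
  have subK: "is_subfield K" using K by (simp add: number_field_def)
  note clK = subfield_closed[OF subK]
  from number_field_local_rings[OF K] obtain R :: "nat \<Rightarrow> 'a set" where
    R0: "\<And>p. prime p \<Longrightarrow> 0 \<in> R p" and R1: "\<And>p. prime p \<Longrightarrow> 1 \<in> R p" and
    R_add: "\<And>p x y. prime p \<Longrightarrow> x \<in> R p \<Longrightarrow> y \<in> R p \<Longrightarrow> x + y \<in> R p" and
    R_mult: "\<And>p x y. prime p \<Longrightarrow> x \<in> R p \<Longrightarrow> y \<in> R p \<Longrightarrow> x * y \<in> R p" and
    R_uminus: "\<And>p x. prime p \<Longrightarrow> x \<in> R p \<Longrightarrow> - x \<in> R p" and
    R_inverse: "\<And>p. prime p \<Longrightarrow> inverse (of_nat p) \<notin> R p" and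
    R_denom: "\<And>z. z \<in> K \<Longrightarrow> \<exists>N>0. \<forall>p. prime p \<longrightarrow> of_nat N * z \<in> R p \<and> (\<not> p dvd N \<longrightarrow> z \<in> R p)" and
    R_unram: "\<exists>N>0. \<forall>p. prime p \<longrightarrow> \<not> p dvd N \<longrightarrow>
       (\<forall>u\<in>R p. \<forall>y\<in>K. y\<^sup>2 = of_nat p * u \<longrightarrow> u / of_nat p \<in> R p)"
    by blast
  have R_nat: "of_nat m \<in> R p" if "prime p" for p m
    by (induction m) (auto intro: R0 R1 R_add that)
  define D where "D = 1 + a\<^sup>2 + b\<^sup>2 + c\<^sup>2"
  have D: "D \<in> K" unfolding D_def using abc by (intro clK)
  obtain Na Nb Nc Nd where N: "Na > 0" "Nb > 0" "Nc > 0" "Nd > 0"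
    "of_nat Na * a \<in> R 2" "of_nat Nb * b \<in> R 2" "of_nat Nc * c \<in> R 2" "of_nat Nd * D \<in> R 2"
    using R_denom[OF abc(1)] R_denom[OF abc(2)] R_denom[OF abc(3)] R_denom[OF D]
    by (metis two_is_prime_nat)
  \<comment> \<open>The denominators at 2 of \<open>a\<close>, \<open>b\<close>, \<open>c\<close>
    and \<open>D\<close> all divide \<open>t\<close>, with a factor 2 to spare, so \<open>t\<close>
    itself and its products with these four become even.\<close>
  define t where "t = 2 * (Na * Nb * Nc * Nd)"
  have t0: "t > 0" using N by (simp add: t_def)
  interpret O: odd_ring "R 2"
    using R0[of 2] R1[of 2] R_add[of 2] R_mult[of 2] R_uminus[of 2] R_inverse[of 2]
    by unfold_locales auto
  have even: "of_nat (t * q) * z \<in> O.evens" if "z \<in> {1, a, b, c, D}" for q z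
  proof -
    have "\<exists>m n. t = 2 * (m * n) \<and> of_nat n * z \<in> R 2"
    proof -
      have "t = 2 * (Nb * Nc * Nd * Na)" "t = 2 * (Na * Nc * Nd * Nb)" "t = 2 * (Na * Nb * Nd * Nc)"
        "t = 2 * (Na * Nb * Nc * Nd)" "t = 2 * (Na * Nb * Nc * Nd * 1)" by (simp_all add: t_def)
      then show ?thesis using that N R1[of 2] by (metis insertE of_nat_1 mult_1 singletonD two_is_prime_nat)
    qed
    then obtain m n where mn: "t = 2 * (m * n)" "of_nat n * z \<in> R 2" by blast
    have "of_nat (t * q) * z = 2 * (of_nat (m * q) * (of_nat n * z))"
      unfolding mn by simp
    also have "\<dots> \<in> O.evens"
      by (intro O.evensI R_mult R_nat mn(2)) simp_all
    finally show ?thesis .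
  qed
  \<comment> \<open>\<open>D\<close> is the offset and \<open>inverse (of_nat (t * q))\<close> the
    nonnegative summand \<open>r\<close> of \<open>cubic_value_nonneg\<close>; the latter also
    creates the denominators at 2 and at \<open>q\<close>.\<close>
  define Xc where "Xc q = D + inverse (of_nat (t * q))" for q
  define V where "V q = cubic a b c (Xc q)" for q
  have XK: "Xc q \<in> K" for q unfolding Xc_def using D by (intro clK)
  have VK: "V q \<in> K" for q unfolding V_def cubic_def using abc XK by (intro clK)
  have "V q \<in> nonneg" for q
    unfolding V_def cubic_def
    by (rule cubic_value_nonneg[OF _ _ _ inverse_of_nat_nonneg[of "t * q"]])
      (simp_all add: fixed abc Xc_def D_def)
  then have "\<exists>w. w\<^sup>2 = V q \<and> \<sigma> w = w" for q
    unfolding nonneg_def by (smt (verit) mem_Collect_eq)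
  then obtain root where root: "\<And>q. (root q)\<^sup>2 = V q" "\<And>q. \<sigma> (root q) = root q"
    by metis
  have two: "\<exists>M>0. \<forall>p. prime p \<longrightarrow> \<not> p dvd M \<longrightarrow> z \<in> R p \<and> z' \<in> R p" if zz: "z \<in> K" "z' \<in> K" for z z'
  proof -
    obtain M M' where "M > 0" "M' > 0" "\<forall>p. prime p \<longrightarrow> \<not> p dvd M \<longrightarrow> z \<in> R p"
      "\<forall>p. prime p \<longrightarrow> \<not> p dvd M' \<longrightarrow> z' \<in> R p"
      using R_denom[OF zz(1)] R_denom[OF zz(2)] by metis
    then show ?thesis
      by (intro exI[of _ "M * M'"]) (auto simp: prime_dvd_mult_iff)
  qed
  \<comment> \<open>Outside the primes dividing \<open>M q\<close>, the value \<open>V q\<close> and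
    its inverse are integral. That the values actually chosen are nonzero comes later, from
    \<open>V_eq\<close>.\<close>
  have "\<forall>q. \<exists>M>0. \<forall>p. prime p \<longrightarrow> \<not> p dvd M \<longrightarrow> V q \<in> R p \<and> inverse (V q) \<in> R p"
    using two VK clK(10) by blast
  then obtain M where M: "\<And>q. M q > (0::nat)"
      "\<And>q p. prime p \<Longrightarrow> \<not> p dvd M q \<Longrightarrow> V q \<in> R p \<and> inverse (V q) \<in> R p"
    by metis
  obtain M1 where M1: "M1 > 0" "\<And>p. prime p \<Longrightarrow> \<not> p dvd M1 \<Longrightarrow> a \<in> R p \<and> b \<in> R p"
    using two[OF abc(1,2)] by blast
  obtain M2 where M2: "M2 > 0" "\<And>p. prime p \<Longrightarrow> \<not> p dvd M2 \<Longrightarrow> c \<in> R p \<and> D \<in> R p"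
    using two[OF abc(3) D] by blast
  obtain M3 where M3: "M3 > 0" "\<And>p. prime p \<Longrightarrow> \<not> p dvd M3 \<Longrightarrow> inverse (of_nat t) \<in> R p"
    using R_denom[OF clK(10)[OF clK(4)[of t]]] by blast
  obtain M4 where M4: "M4 > 0" "\<And>p u y. prime p \<Longrightarrow> \<not> p dvd M4 \<Longrightarrow> u \<in> R p \<Longrightarrow> y \<in> K \<Longrightarrow>
      y\<^sup>2 = of_nat p * u \<Longrightarrow> u / of_nat p \<in> R p"
    using R_unram by blast
  obtain nxt :: "nat \<Rightarrow> nat" where nxt: "\<And>n. prime (nxt n) \<and> nxt n > n"
    using bigger_prime by metis
  \<comment> \<open>The recursion makes each chosen prime exceed \<open>M\<close> at all earlier
    ones, so the earlier values are units there. Starting at the sum of the \<open>Mi\<close> also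
    avoids the denominators of the coefficients, the divisors of \<open>t\<close> and the ramified
    primes.\<close>
  define bound where "bound = rec_nat (M1 + M2 + M3 + M4) (\<lambda>_ k. max k (M (nxt k)))"
  have bound_Suc: "bound (Suc n) = max (bound n) (M (nxt (bound n)))" for n
    by (simp add: bound_def)
  have bound_0: "bound 0 = M1 + M2 + M3 + M4" by (simp add: bound_def)
  have bound_mono: "bound i \<le> bound n" if "i \<le> n" for i n
    using that by (rule lift_Suc_mono_le[rotated]) (simp add: bound_Suc)
  define q where "q n = nxt (bound n)" for n
  have q: "prime (q n)" "q n > bound n" for n using nxt by (auto simp: q_def)
  have not_dvd: "\<not> q n dvd m" if "0 < m" "m \<le> bound n" for m n
    using that q(2)[of n] by (auto dest: dvd_imp_le)
  have "M1 + M2 + M3 + M4 \<le> bound n" for n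
    using bound_0 bound_mono[of 0 n] by simp
  then have "M1 \<le> bound n" "M2 \<le> bound n" "M3 \<le> bound n" "M4 \<le> bound n" for n
    by (meson add_leE)+
  then have qM: "\<not> q n dvd M1" "\<not> q n dvd M2" "\<not> q n dvd M3" "\<not> q n dvd M4" for n
    using not_dvd M1(1) M2(1) M3(1) M4(1) by blast+
  have qMi: "\<not> q n dvd M (q i)" if "i < n" for i n
  proof (rule not_dvd[OF M(1)])
    have "M (q i) \<le> bound (Suc i)" by (simp add: bound_Suc q_def)
    also have "\<dots> \<le> bound n" using that by (intro bound_mono) simp
    finally show "M (q i) \<le> bound n" .
  qed
  \<comment> \<open>As \<open>Xc q = s / T\<close> with \<open>T = t * q\<close> and
    \<open>s = 1 + T * D\<close>, the product \<open>V q * T^3\<close> is 1 modulo \<open>T\<close>.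
    One more factor \<open>T\<close> makes the multiplier \<open>T^4\<close> a square and brings out
    a single \<open>q\<close>.\<close>
  have V_eq: "\<exists>h\<in>R (q n). V (q n) * of_nat (t * q n) ^ 4 = of_nat (q n) * (of_nat t * (1 + of_nat (q n) * h))"
    for n
  proof -
    define p T s where pTs: "p = q n" "T = of_nat (t * p)" "s = 1 + T * D"
    have p: "prime p" using q pTs by simp
    note cl = R_add[OF p] R_mult[OF p] R_nat[OF p] R1[OF p]
    have mem: "a \<in> R p" "b \<in> R p" "c \<in> R p" "D \<in> R p"
      using M1(2)[OF q(1) qM(1)] M2(2)[OF q(1) qM(2)] by (auto simp: pTs)
    have T: "T \<in> R p" unfolding pTs(2) by (rule R_nat[OF p])
    have s: "s \<in> R p" unfolding pTs(3) by (intro cl T mem)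
    define h where "h = of_nat t * (of_nat 3 * D + of_nat 3 * T * (D * D) + T * T * (D * D * D)
      + a * (s * s) + b * s * T + c * (T * T))"
    have hR: "h \<in> R p" unfolding h_def by (intro cl T s mem)
    have T0: "T \<noteq> 0" using t0 p by (auto simp: pTs)
    have Xs: "Xc p = s / T" unfolding Xc_def pTs(3) using T0 by (simp add: pTs(2) field_simps)
    have "V p * T ^ 3 = s ^ 3 + a * s\<^sup>2 * T + b * s * T\<^sup>2 + c * T ^ 3"
      unfolding V_def cubic_def Xs using T0 by (simp add: field_simps power2_eq_square power3_eq_cube)
    also have "\<dots> = 1 + T * (of_nat 3 * D + of_nat 3 * T * (D * D) + T * T * (D * D * D)
      + a * (s * s) + b * s * T + c * (T * T))"
    proof -
      have "s ^ 3 = 1 + T * (of_nat 3 * D + of_nat 3 * T * (D * D) + T * T * (D * D * D))"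
        unfolding pTs(3) by (simp add: ring_normal)
      then show ?thesis by (simp add: ring_normal)
    qed
    also have "\<dots> = 1 + of_nat p * h"
      unfolding h_def pTs(2) by (simp add: mult.assoc mult.left_commute)
    finally have "V p * T ^ 4 = T * (1 + of_nat p * h)"
      by (simp add: power4_eq_xxxx power3_eq_cube mult.assoc mult.left_commute)
    then show ?thesis using hR unfolding pTs(2) by (intro bexI[of _ h]) (simp_all add: pTs(1) ac_simps)
  qed
  have q0: "(of_nat (q n) :: 'a) \<noteq> 0" for n using q(1)[of n] by auto
  have ti: "inverse (of_nat t) \<in> R (q n)" for n using M3(2)[OF q(1) qM(3)] .
  have not_div: "(1 + of_nat (q n) * h) / of_nat (q n) \<notin> R (q n)" if h: "h \<in> R (q n)" for n h
  proof
    assume "(1 + of_nat (q n) * h) / of_nat (q n) \<in> R (q n)"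
    from R_add[OF q(1) this R_uminus[OF q(1) h]] have "inverse (of_nat (q n)) \<in> R (q n)"
      using q0 by (simp add: field_simps)
    then show False using R_inverse[OF q(1)] by blast
  qed
  have V0: "V (q n) \<noteq> 0" for n
  proof
    assume "V (q n) = 0"
    with V_eq[of n] q0[of n] t0 obtain h where h: "h \<in> R (q n)" "1 + of_nat (q n) * h = 0"
      by auto
    then show False using not_div[OF h(1)] R0[OF q(1)] by simp
  qed
  define y where "y n = root (q n)" for n
  have y2: "(y n)\<^sup>2 = V (q n)" for n by (simp add: y_def root)
  have not_tower: "y n \<notin> quadratic_tower K y n" for n
  proof
    assume "y n \<in> quadratic_tower K y n"
    from quadratic_tower_square[OF subK _ this] y2 VK
    obtain S where S: "S \<subseteq> {..<n}" "y n * (\<Prod>i\<in>S. y i) \<in> K" by metis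
    define e where "e = (\<Prod>i\<in>S. V (q i))"
    have prod: "prod g J \<in> R (q n)" if "\<And>j. j \<in> J \<Longrightarrow> g j \<in> R (q n)" for g and J :: "nat set"
      using that by (induction J rule: infinite_finite_induct) (auto intro: R1 R_mult q(1))
    have VR: "V (q i) \<in> R (q n)" "inverse (V (q i)) \<in> R (q n)" if "i \<in> S" for i
      using M(2)[OF q(1) qMi[of i n]] that S by auto
    have eR: "e \<in> R (q n)" "inverse e \<in> R (q n)"
      unfolding e_def prod_inversef[symmetric] comp_def by (rule prod, rule VR, assumption)+
    have e0: "e \<noteq> 0" unfolding e_def using V0 finite_subset[OF S(1)] by (simp add: prod_zero_iff)
    obtain h where h: "h \<in> R (q n)"
      "V (q n) * of_nat (t * q n) ^ 4 = of_nat (q n) * (of_nat t * (1 + of_nat (q n) * h))"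
      using V_eq by blast
    \<comment> \<open>The square of \<open>w\<close> is \<open>q\<close> times \<open>u\<close>. If
      the tower contained \<open>y n\<close>, then \<open>w\<close> would lie in \<open>K\<close>
      and \<open>u\<close> would be divisible by \<open>q\<close>; cancelling the units
      \<open>e\<close> and \<open>t\<close> contradicts \<open>not_div\<close>.\<close>
    define u where "u = of_nat t * (1 + of_nat (q n) * h) * e"
    define w where "w = y n * (\<Prod>i\<in>S. y i) * of_nat (t * q n) ^ 2"
    have wK: "w \<in> K" unfolding w_def by (rule clK(7)[OF S(2) clK(11)[OF clK(4)]])
    have "w\<^sup>2 = (y n)\<^sup>2 * (\<Prod>i\<in>S. (y i)\<^sup>2) * of_nat (t * q n) ^ 4"
      unfolding w_def power_mult_distrib prod_power_distrib by (simp flip: power_mult)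
    also have "\<dots> = (V (q n) * of_nat (t * q n) ^ 4) * e"
      unfolding y2 e_def by (simp only: ac_simps)
    also have "\<dots> = of_nat (q n) * u"
      unfolding h(2) u_def by (simp only: mult.assoc)
    finally have w2: "w\<^sup>2 = of_nat (q n) * u" .
    have "u \<in> R (q n)"
      unfolding u_def by (intro R_mult R_add R_nat R1 q(1) h(1) eR)
    from M4(2)[OF q(1) qM(4) this wK w2] have "u / of_nat (q n) \<in> R (q n)" .
    then have "u / of_nat (q n) * (inverse e * inverse (of_nat t)) \<in> R (q n)"
      by (intro R_mult q(1) eR ti)
    moreover have "u / of_nat (q n) * (inverse e * inverse (of_nat t)) = (1 + of_nat (q n) * h) / of_nat (q n)"
      unfolding u_def using e0 t0 q0[of n] by (simp add: field_simps)
    ultimately show False using not_div[OF h(1)] by metis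
  qed
  show ?thesis
  proof (rule that[of "R 2" "\<lambda>n. of_nat (t * q n)" "\<lambda>n. Xc (q n)" y])
    show "odd_ring (R 2)" by (rule O.odd_ring_axioms)
    fix n
    have T0: "(of_nat (t * q n) :: 'a) \<noteq> 0" using t0 q0[of n] by simp
    show "of_nat (t * q n) \<noteq> (0::'a) \<and> {of_nat (t * q n), of_nat (t * q n) * a, of_nat (t * q n) * b,
        of_nat (t * q n) * c} \<subseteq> O.evens"
      using T0 even[of 1 "q n"] even[of a "q n"] even[of b "q n"] even[of c "q n"] by simp
    have "1 + of_nat (t * q n) * D \<in> O.odds"
      by (intro O.odds_add_even O.one_odd even) simp
    moreover have "Xc (q n) = (1 + of_nat (t * q n) * D) / of_nat (t * q n)"
      unfolding Xc_def using T0 by (simp add: add_divide_distrib inverse_eq_divide)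
    ultimately show "\<exists>s\<in>O.odds. Xc (q n) = s / of_nat (t * q n)" by blast
    show "(y n)\<^sup>2 = cubic a b c (Xc (q n))" using y2 by (simp add: V_def)
  qed (use XK root not_tower in \<open>auto simp: y_def\<close>)
qed

section \<open>Independence of the points\<close>

lemma mordell_weil_group_rank_infinite:
  fixes K L :: "'a::{field_char_0, alg_closed_field} set" and E :: "'a weierstrass"
  defines "a \<equiv> wa2 E + (wa1 E)\<^sup>2 / 4" and "b \<equiv> wa4 E + wa1 E * wa3 E / 2"
    and "c \<equiv> wa6 E + (wa3 E)\<^sup>2 / 4"
  assumes K: "is_subfield K" and L: "is_subfield L" and KL: "K \<subseteq> L"
    and E: "elliptic_curve_over K E"
    and A: "odd_ring A"
    and T: "\<And>n. T n \<noteq> 0 \<and> {T n, T n * a, T n * b, T n * c} \<subseteq> odd_ring.evens A"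
    and xT: "\<And>n. \<exists>s\<in>odd_ring.odds A. x n = s / T n" and x: "\<And>n. x n \<in> K"
    and y: "\<And>n. (y n)\<^sup>2 = cubic a b c (x n)" and yL: "\<And>n. y n \<in> L"
    and not_tower: "\<And>n. y n \<notin> quadratic_tower K y n"
  shows "abelian_group_rank (mordell_weil_group E L) = \<infinity>"
proof -
  define G where "G = mordell_weil_group E L"
  have coeffs: "wa1 E \<in> K" "wa2 E \<in> K" "wa3 E \<in> K" "wa4 E \<in> K" "wa6 E \<in> K"
    and disc: "discriminant E \<noteq> 0"
    using E by (auto simp: elliptic_curve_over_def)
  have abc: "a \<in> K" "b \<in> K" "c \<in> K"
    unfolding a_def b_def c_def using coeffs by (auto intro!: subfield_closed[OF K])
  have sc: "square_completed E = cubic_curve a b c"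
    by (simp add: square_completed_def a_def b_def c_def)
  interpret nonsingular_cubic a b c
    unfolding a_def b_def c_def by (rule square_completed_nonsingular[OF disc])
  have EL: "elliptic_curve_over M E" if "K \<subseteq> M" for M
    using E that by (auto simp: elliptic_curve_over_def)
  interpret G: comm_group G
    unfolding G_def by (rule comm_group_mordell_weil_group[OF L EL[OF KL]])
  have G_simps: "carrier G = ec_points E L" "\<one>\<^bsub>G\<^esub> = Infinity" "P \<otimes>\<^bsub>G\<^esub> Q = ec_add E P Q" for P Q
    by (simp_all add: G_def mordell_weil_group_def)
  have y2: "(y n)\<^sup>2 \<in> K" for n
    unfolding y cubic_def using x abc by (intro subfield_closed[OF K])
  define F where "F = quadratic_tower K y"
  have F: "is_subfield (F n)" "K \<subseteq> F n" for n
    using quadratic_tower_subfield[where K = K and y = y, OF K y2] by (auto simp: F_def)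
  have yF: "y i \<in> F n" if "i < n" for i n
    unfolding F_def using quadratic_tower_generator[where K = K and y = y, OF K y2 that] .
  have y_notin: "y n \<notin> F n" for n using not_tower by (simp add: F_def)
  have UL: "P \<in> ec_points E UNIV" if "P \<in> ec_points E M" for P M
    using that ec_points_iff by blast
  have cadd: "complete_square E (ec_add E Q R) = complete_square E Q \<boxplus> complete_square E R"
    if "Q \<in> ec_points E L" "R \<in> ec_points E L" for Q R
    using complete_square_add[OF UL[OF that(1)] UL[OF that(2)]] unfolding sc .
  have inv: "inv\<^bsub>G\<^esub> P = ec_neg E P" if "P \<in> carrier G" for P
    by (rule G.inv_equality)
      (use that ec_neg_in_ec_points[OF L EL[OF KL]] in \<open>auto simp: G_simps ec_add_ec_neg\<close>)
  define P where "P n = Affine (x n) (y n - (wa1 E * x n + wa3 E) / 2)" for n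
  have cP: "complete_square E (P n) = Affine (x n) (y n)" for n by (simp add: P_def)
  have P_UNIV: "P n \<in> ec_points E UNIV" for n
    using complete_square_in_ec_points[of E "P n"] y unfolding cP sc by simp
  have P_in: "P n \<in> ec_points E M" if M: "is_subfield M" "K \<subseteq> M" "y n \<in> M" for n M
  proof -
    have "x n \<in> M" "wa1 E \<in> M" "wa3 E \<in> M" using x coeffs M by auto
    then have "y n - (wa1 E * x n + wa3 E) / 2 \<in> M"
      using M by (intro subfield_closed[OF M(1)])
    then show ?thesis
      using P_UNIV[of n] \<open>x n \<in> M\<close> ec_points_iff[of "P n" E M] by (simp add: P_def)
  qed
  have PG: "P n \<in> carrier G" for n
    using P_in[OF L KL yL] by (simp add: G_simps)
  \<comment> \<open>Intersecting with the points over \<open>L\<close> places \<open>H n\<close>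
    inside the carrier directly, without a comparison of \<open>F n\<close> and
    \<open>L\<close>.\<close>
  define H where "H n = ec_points E (F n) \<inter> ec_points E L" for n
  have "subgroup (H n) G" for n
  proof (rule G.subgroupI)
    show "H n \<noteq> {}" by (auto simp: H_def ec_points_def)
    show "inv\<^bsub>G\<^esub> Q \<in> H n" if "Q \<in> H n" for Q
      using that inv ec_neg_in_ec_points[OF F(1) EL[OF F(2)]] ec_neg_in_ec_points[OF L EL[OF KL]]
      by (simp add: H_def G_simps)
    show "Q \<otimes>\<^bsub>G\<^esub> R \<in> H n" if "Q \<in> H n" "R \<in> H n" for Q R
      using that ec_add_in_ec_points[OF F(1) EL[OF F(2)]] ec_add_in_ec_points[OF L EL[OF KL]]
      by (simp add: H_def G_simps)
  qed (auto simp: H_def G_simps)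
  moreover have "P i \<in> H n" if "i < n" for i n
    using P_in[OF F yF[OF that]] P_in[OF L KL yL] by (simp add: H_def)
  moreover have "P n [^]\<^bsub>G\<^esub> k \<notin> H n" if k: "k \<noteq> 0" for n and k :: int
  proof
    assume kH: "P n [^]\<^bsub>G\<^esub> k \<in> H n"
    \<comment> \<open>The subgroup of points coming from the twist by \<open>y n\<close>. It
      contains \<open>P n\<close>, with \<open>v = 1\<close>, and hence all multiples of
      \<open>P n\<close>.\<close>
    define W where "W = {Q \<in> ec_points E L. complete_square E Q \<in> twist_points (F n) (y n)}"
    have yn: "y n \<noteq> 0" using y_notin[of n] subfield_closed(1)[OF F(1)] by auto
    have abF: "a \<in> F n" "b \<in> F n" and y2F: "(y n)\<^sup>2 \<in> F n" using abc y2 F by blast+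
    have neg: "complete_square E (ec_neg E Q) = xneg (complete_square E Q)" for Q
      by (cases Q) (simp_all add: field_simps)
    have W: "subgroup W G"
    proof (rule G.subgroupI)
      have "Infinity \<in> W" by (simp add: W_def ec_points_def twist_points_def)
      then show "W \<noteq> {}" by blast
      show "inv\<^bsub>G\<^esub> Q \<in> W" if "Q \<in> W" for Q
        using that inv ec_neg_in_ec_points[OF L EL[OF KL]] twist_points_xneg[OF F(1)]
        by (simp add: W_def G_simps neg)
      show "Q \<otimes>\<^bsub>G\<^esub> R \<in> W" if "Q \<in> W" "R \<in> W" for Q R
        using that ec_add_in_ec_points[OF L EL[OF KL]] twist_points_add[OF F(1) abF y2F yn]
        by (simp add: W_def G_simps cadd)
    qed (auto simp: W_def G_simps)
    have "Affine (x n) (1 * y n) \<in> twist_points (F n) (y n)"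
      unfolding twist_points_def using x F(2) subfield_closed(2)[OF F(1)] by blast
    then have "P n \<in> W"
      using PG[of n] by (simp add: W_def G_simps cP)
    then have kW: "P n [^]\<^bsub>G\<^esub> k \<in> W"
      by (rule G.subgroup_int_pow_closed[OF W])
    define Q where "Q = P n [^]\<^bsub>G\<^esub> k"
    have Q: "Q \<in> ec_points E L" "Q \<in> ec_points E (F n)" "complete_square E Q \<in> twist_points (F n) (y n)"
      using kH kW by (auto simp: Q_def W_def H_def)
    have "ec_add E Q Q = Infinity"
    proof (cases Q)
      case (Affine u w)
      have uw: "u \<in> F n" "w \<in> F n" using Q(2) ec_points_iff[of Q E "F n"] Affine by auto
      obtain v where v: "v \<in> F n" "w + (wa1 E * u + wa3 E) / 2 = v * y n"
        using Q(3) by (auto simp: Affine twist_points_def)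
      have "wa1 E \<in> F n" "wa3 E \<in> F n" using coeffs F(2) by blast+
      then have vyF: "v * y n \<in> F n" unfolding v(2)[symmetric] using uw by (intro subfield_closed[OF F(1)])
      have "v = 0"
      proof (rule ccontr)
        assume "v \<noteq> 0"
        then have "y n = v * y n / v" by simp
        also have "\<dots> \<in> F n" using vyF v(1) by (rule subfield_closed(8)[OF F(1)])
        finally show False using y_notin by blast
      qed
      then have "complete_square E (ec_add E Q Q) = complete_square E Infinity"
        unfolding cadd[OF Q(1,1)] using v(2) by (simp add: Affine)
      then show ?thesis unfolding complete_square_inject .
    qed simp
    then have "P n [^]\<^bsub>G\<^esub> (k + k) = \<one>\<^bsub>G\<^esub>"
      using G.int_pow_mult[OF PG, of n k k] by (simp add: Q_def G_simps)
    moreover have "inj (\<lambda>j. P n [^]\<^bsub>G\<^esub> (2 ^ j :: nat))"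
    proof -
      interpret O: odd_ring A by (rule A)
      interpret O: cubic_odd_ring a b c A "T n"
        using T[of n] by unfold_locales auto
      obtain s where s: "s \<in> O.odds" "x n = s / T n" using xT by blast
      define D where "D j = complete_square E (P n [^]\<^bsub>G\<^esub> (2 ^ j :: nat))" for j
      have "D 0 = Affine (x n) (y n)" using PG cP by (simp add: D_def)
      moreover have "D (Suc j) = D j \<boxplus> D j" for j
      proof -
        have R: "P n [^]\<^bsub>G\<^esub> (2 ^ j :: nat) \<in> ec_points E L"
          using PG[of n] G.nat_pow_closed by (simp add: G_simps)
        have "P n [^]\<^bsub>G\<^esub> (2 ^ Suc j :: nat) = P n [^]\<^bsub>G\<^esub> (2 ^ j :: nat) \<otimes>\<^bsub>G\<^esub> P n [^]\<^bsub>G\<^esub> (2 ^ j :: nat)"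
          using G.nat_pow_mult[OF PG, of n "2 ^ j" "2 ^ j"] by (simp add: mult_2)
        then show ?thesis
          using cadd[OF R R] by (simp add: D_def G_simps)
      qed
      ultimately have "inj D"
        using O.iterated_doubling_inj[OF y s(2,1)] by blast
      then show ?thesis
        by (auto simp: D_def inj_def)
    qed
    ultimately show False
      using G.int_pow_neq_one_of_inj_doublings[OF PG, of n "k + k"] k by simp
  qed
  ultimately have "abelian_group_rank G = \<infinity>"
    using G.rank_infinite[of H P] PG by blast
  then show ?thesis by (simp add: G_def)
qed

theorem theorem4p4:
  fixes K :: "'a::{field_char_0, alg_closed_field} set"
    and E :: "'a weierstrass"
    and \<sigma> :: "'a \<Rightarrow> 'a"
  assumes "number_field K"
    and "\<forall>x :: 'a. algebraic_over K x"
    and "elliptic_curve_over K E"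
    and "complex_conjugation K \<sigma>"
  shows "abelian_group_rank (mordell_weil_group E (fixed_field (max_abelian_extension K) \<sigma>)) = \<infinity> \<and>
         abelian_group_rank (mordell_weil_group E (fixed_field UNIV \<sigma>)) = \<infinity>"
proof -
  interpret involution \<sigma>
    using complex_conjugationD[OF assms(4)] by unfold_locales auto
  have K: "is_subfield K" using assms(1) by (simp add: number_field_def)
  have abc: "wa2 E + (wa1 E)\<^sup>2 / 4 \<in> K" "wa4 E + wa1 E * wa3 E / 2 \<in> K" "wa6 E + (wa3 E)\<^sup>2 / 4 \<in> K"
    using assms(3) unfolding elliptic_curve_over_def by (auto intro!: subfield_closed[OF K])
  from exists_independent_points[OF assms(1) complex_conjugationD(4)[OF assms(4)] abc]
  obtain A T x y where pts: "odd_ring A"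
    "\<And>n. T n \<noteq> 0 \<and> {T n, T n * (wa2 E + (wa1 E)\<^sup>2 / 4), T n * (wa4 E + wa1 E * wa3 E / 2),
       T n * (wa6 E + (wa3 E)\<^sup>2 / 4)} \<subseteq> odd_ring.evens A"
    "\<And>n. \<exists>s\<in>odd_ring.odds A. x n = s / T n" "\<And>n. x n \<in> K"
    "\<And>n. (y n)\<^sup>2 = cubic (wa2 E + (wa1 E)\<^sup>2 / 4) (wa4 E + wa1 E * wa3 E / 2) (wa6 E + (wa3 E)\<^sup>2 / 4) (x n)"
    and y_fixed: "\<And>n. \<sigma> (y n) = y n" and not_tower: "\<And>n. y n \<notin> quadratic_tower K y n"
    by blast
  have y2: "(y n)\<^sup>2 \<in> K" for n
    unfolding pts(5) cubic_def
    by (rule subfield_closed(5-7,11)[OF K] pts(4) abc)+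
  have yK: "y n \<notin> K" for n
    using not_tower[of n] quadratic_tower_subfield[where K = K and y = y and n = n, OF K y2] by blast
  have ab: "quadratic_extension K (y n) \<subseteq> max_abelian_extension K" for n
    by (rule quadratic_extension_subset_max_abelian[OF K y2 yK])
  note sup = quadratic_extension_superset[OF K]
  \<comment> \<open>Both fields in the claim arise from some \<open>M\<close> containing
    \<open>K\<close> and all \<open>y n\<close>, so the same points settle the two ranks.\<close>
  have rank: "abelian_group_rank (mordell_weil_group E (fixed_field M \<sigma>)) = \<infinity>"
    if M: "is_subfield M" "K \<subseteq> M" "\<And>n. y n \<in> M" for M
    by (rule mordell_weil_group_rank_infinite[where y = y, OF K is_subfield_fixed_field[OF M(1)] _ assms(3) pts])
      (use M y_fixed not_tower complex_conjugationD(4)[OF assms(4)] in \<open>auto simp: fixed_field_def\<close>)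
  have "K \<subseteq> max_abelian_extension K" using sup(1) ab by blast
  moreover have "y n \<in> max_abelian_extension K" for n using sup(2) ab by blast
  moreover have "is_subfield (UNIV :: 'a set)" by (simp add: is_subfield_iff)
  ultimately show ?thesis
    using rank[OF is_subfield_max_abelian_extension] rank[of UNIV] by simp
qed

end
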